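(* Let $n\ge1$ and $\lambda\in\Lambda_n^+$. The highest term of $N_k(\lambda)$ as a polynomial in $p$ is given by $$\mathrm{hterm}(N_k(\lambda))=C(n,\lambda;k)\,p^{\ell k+a_\ell(\lambda)}\quad\text{if } k\in J_\ell(\lambda),\ 0\le \ell\le n-1,$$ $$\mathrm{hterm}(N_k(\lambda))=\mathrm{hterm}(N_{|\lambda|-k}(\lambda))\quad\text{if } |\lambda|/2\le k\le|\lambda|$$ (so that it equals $C(n,\lambda;|\lambda|-k)\,p^{-\ell k+\ell|\lambda|+a_\ell(\lambda)}$ if $k\in J_{-\ell}(\lambda)$, $1\le\ell\le n-1$). Here $C(n,\lambda;k)=1$ if $n\le 2$, and in general (for $n\ge2$) $$C(n,\lambda;k)=\begin{cases} C(n-\ell,\lambda^{(\ell)};k) & \text{if } k\in J_\ell(\lambda)=J_0(\lambda^{(\ell)}),\ 1\le \ell\le n-1,\\[2mm] \displaystyle\sum_{i=\max\{ev_\lambda,\;k-\lambda_1+\lambda_2\}}^{\min\{k,\;od_\lambda-\lambda_1+\lambda_2\}} C(n-1,\lambda';i) & \text{if } k\in J_0(\lambda).\end{cases}$$ Further, for each $\ell$ with $0\le\ell\le n-1$, the sequence $C(n,\lambda;k)$, $k\in J_\ell(\lambda)$, is unimodal and symmetric with respect to $|\lambda^{(\ell)}|/2$, and $C(n,\lambda;c_\ell(\lambda))=1$. In particular, $H_n(\lambda)=a_0(\lambda)=\sum_{i=2}^n\left[\frac i2\right]\lambda_i$.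
   Context: $[x]$ denotes the integer part. For $n\ge1$, $\Lambda_n^+=\{\lambda\in\mathbb Z^n:\lambda_1\ge\lambda_2\ge\cdots\ge\lambda_n>0\}$, and $|\lambda|=\sum_{i=1}^n\lambda_i$. For a prime $p$, $G_\lambda=\mathbb Z/p^{\lambda_1}\mathbb Z\oplus\cdots\oplus\mathbb Z/p^{\lambda_n}\mathbb Z$, and $N_k(\lambda)$ is the number of subgroups of $G_\lambda$ of order $p^k$. It is known that for each $\lambda$ and $k$ there is one polynomial with integer coefficients whose value at every prime $p$ is $N_k(\lambda)$; $N_k(\lambda)$ is identified with this polynomial in the variable $p$. For a polynomial $g$, $\mathrm{hterm}(g)$ is its highest (leading) term and $\mathrm{hdeg}(g)$ its degree. Put $H_n(\lambda)=\max\{\mathrm{hdeg}(N_k(\lambda)):0\le k\le|\lambda|\}$. For $\lambda\in\Lambda_n^+$ define $c_\ell(\lambda)=\lambda_{\ell+1}+\lambda_{\ell+3}+\lambda_{\ell+5}+\cdots$ for $0\le\ell\le n-1$ (sum over indices $\le n$ of the form $\ell+1+2j$, $j\ge0$), $c_n(\lambda)=0$, and $c_{-\ell}(\lambda)=|\lambda|-c_\ell(\lambda)$ for $1\le\ell\le n$. In particular $ev_\lambda=c_1(\lambda)=\sum_{i=1}^{[n/2]}\lambda_{2i}$ and $od_\lambda=c_{-1}(\lambda)=c_0(\lambda)=\sum_{i=0}^{[(n-1)/2]}\lambda_{2i+1}$. Define the integer intervals $J_0(\lambda)=[ev_\lambda,od_\lambda]$ and, for $1\le\ell\le n-1$, $J_\ell(\lambda)=[c_{\ell+1}(\lambda),c_\ell(\lambda)]$,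 $J_{-\ell}(\lambda)=[c_{-\ell}(\lambda),c_{-(\ell+1)}(\lambda)]$; together they cover $[0,|\lambda|]$. For $0\le\ell\le n-1$ set $a_\ell(\lambda)=\sum_{i=\ell+2}^n\left[\frac{i-\ell}{2}\right]\lambda_i$ (so $a_{n-1}(\lambda)=0$). For $0\le\ell\le n-1$ set $\lambda^{(\ell)}=(\lambda_{\ell+1},\ldots,\lambda_n)\in\Lambda_{n-\ell}^+$ (so $\lambda^{(0)}=\lambda$), and, for $n\ge2$, $\lambda'=\lambda^{(1)}$. One has $J_\ell(\lambda)=J_0(\lambda^{(\ell)})$ for $1\le\ell\le n-1$. The integers $C(n,\lambda;k)$, $0\le k\le|\lambda|$, are defined by recursion on $n$: $C(n,\lambda;k)=1$ for $n\le2$; for $n\ge3$, if $k\in J_0(\lambda)$ it is given by the displayed sum in the claim; if $k<ev_\lambda$, it is $C(n-\ell,\lambda^{(\ell)};k)$ where $\ell\ge1$ is the smallest index with $k\in J_\ell(\lambda)$; if $k>od_\lambda$, it is $C(n,\lambda;|\lambda|-k)$. A finite sequence is unimodal if it is non-decreasing up to some index and non-increasing afterwards; symmetric with respect to $|\lambda^{(\ell)}|/2$ means $C(n,\lambda;k)=C(n,\lambda;|\lambda^{(\ell)}|-k)$ for $k\in J_\ell(\lambda)$. *)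

theory Defs
  imports
    "HOL-Algebra.Product_Groups"
    "HOL-Computational_Algebra.Computational_Algebra"
begin

text \<open>
  An element of \<open>\<Lambda>\<^sub>n\<^sup>+\<close> is a list of natural numbers of length \<open>n\<close>; its entries are addressed
  from 1 by \<open>part\<close>, and \<open>\<lambda>\<^sup>(\<^sup>\<ell>\<^sup>) = (\<lambda>\<^sub>\<ell>\<^sub>+\<^sub>1, \<dots>, \<lambda>\<^sub>n)\<close> is \<open>drop \<ell> \<lambda>\<close>. The number \<open>n\<close> is
  always the length of the list, so it is not a separate argument of the functions below.
\<close>

definition part :: "nat list \<Rightarrow> nat \<Rightarrow> nat" where
  "part lam i = lam ! (i - 1)"

definition Lambda_plus :: "nat \<Rightarrow> nat list set" where
  "Lambda_plus n = {lam. length lam = n \<and> sorted_wrt (\<ge>) lam \<and> (\<forall>x\<in>set lam. x > 0)}"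

definition G_type :: "nat \<Rightarrow> nat list \<Rightarrow> (nat \<Rightarrow> int) monoid" where
  "G_type p lam = product_group {1..length lam} (\<lambda>i. integer_mod_group (p ^ part lam i))"

definition num_subgroups :: "nat \<Rightarrow> nat list \<Rightarrow> nat \<Rightarrow> nat" where
  "num_subgroups p lam k = card {H. subgroup H (G_type p lam) \<and> card H = p ^ k}"

text \<open>
  \<open>N\<^sub>k(\<lambda>)\<close> as a polynomial: the unique integer polynomial whose value at every prime \<open>p\<close> is the
  number of subgroups of order \<open>p\<^sup>k\<close>.
\<close>

definition N_poly :: "nat list \<Rightarrow> nat \<Rightarrow> int poly" where
  "N_poly lam k =
     (THE P. \<forall>p::nat. Factorial_Ring.prime p \<longrightarrow> poly P (int p) = int (num_subgroups p lam k))"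

definition hterm :: "int poly \<Rightarrow> int poly" where
  "hterm g = Polynomial.monom (lead_coeff g) (degree g)"

definition H_max :: "nat list \<Rightarrow> nat" where
  "H_max lam = Max ((\<lambda>k. degree (N_poly lam k)) ` {0..sum_list lam})"

text \<open>
  \<open>c_sum lam l\<close> is \<open>c\<^sub>\<ell>(\<lambda>)\<close> for \<open>0 \<le> \<ell> \<le> n\<close> (the empty sum for \<open>\<ell> = n\<close>), and \<open>c_neg_sum lam l\<close> is
  \<open>c\<^sub>-\<^sub>\<ell>(\<lambda>)\<close>. Likewise for \<open>J_set\<close> and \<open>J_neg_set\<close>; as \<open>ev\<^sub>\<lambda> = c\<^sub>1(\<lambda>)\<close> and \<open>od\<^sub>\<lambda> = c\<^sub>0(\<lambda>)\<close>, the
  formula for \<open>J\<^sub>\<ell>\<close> also covers \<open>J\<^sub>0 = [ev\<^sub>\<lambda>, od\<^sub>\<lambda>]\<close>.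
\<close>

definition c_sum :: "nat list \<Rightarrow> nat \<Rightarrow> nat" where
  "c_sum lam l = (\<Sum>i\<in>{i\<in>{1..length lam}. \<exists>j. i = l + 1 + 2 * j}. part lam i)"

definition c_neg_sum :: "nat list \<Rightarrow> nat \<Rightarrow> nat" where
  "c_neg_sum lam l = sum_list lam - c_sum lam l"

definition ev_sum :: "nat list \<Rightarrow> nat" where
  "ev_sum lam = c_sum lam 1"

definition od_sum :: "nat list \<Rightarrow> nat" where
  "od_sum lam = c_sum lam 0"

definition J_set :: "nat list \<Rightarrow> nat \<Rightarrow> nat set" where
  "J_set lam l = {c_sum lam (l + 1)..c_sum lam l}"

definition J_neg_set :: "nat list \<Rightarrow> nat \<Rightarrow> nat set" where
  "J_neg_set lam l = {c_neg_sum lam l..c_neg_sum lam (l + 1)}"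

definition a_sum :: "nat list \<Rightarrow> nat \<Rightarrow> nat" where
  "a_sum lam l = (\<Sum>i = l + 2..length lam. ((i - l) div 2) * part lam i)"

lemma c_sum_length: "c_sum lam (length lam) = 0"
proof -
  have "{i\<in>{1..length lam}. \<exists>j. i = length lam + 1 + 2 * j} = {}"
    by auto
  then show ?thesis
    unfolding c_sum_def by (metis (no_types, lifting) sum.empty)
qed

lemma c_sum_0_plus_1: "c_sum lam 0 + c_sum lam 1 = sum_list lam"
proof -
  let ?A = "{i\<in>{1..length lam}. \<exists>j. i = 0 + 1 + 2 * j}"
  let ?B = "{i\<in>{1..length lam}. \<exists>j. i = 1 + 1 + 2 * j}"
  have "i \<in> ?A \<union> ?B" if "i \<in> {1..length lam}" for i
    using that by simp presburger
  then have *: "?A \<union> ?B = {1..length lam}"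
    by blast
  have disj: "?A \<inter> ?B = {}"
    by auto presburger
  have "c_sum lam 0 + c_sum lam 1 = sum (part lam) (?A \<union> ?B)"
    unfolding c_sum_def by (rule sum.union_disjoint [symmetric]) (use disj in auto)
  also have "\<dots> = (\<Sum>i = 1..length lam. lam ! (i - 1))"
    unfolding * part_def ..
  also have "\<dots> = (\<Sum>i = 0..<length lam. lam ! i)"
    by (rule sum.reindex_bij_witness [where i = Suc and j = "\<lambda>i. i - 1"]) auto
  finally show ?thesis
    by (simp add: sum_list_sum_nth)
qed

lemma ex_index_below_ev:
  assumes "k < ev_sum lam"
  shows "\<exists>l. 1 \<le> l \<and> k \<in> J_set lam l"
proof -
  define m where "m = (LEAST m. 1 \<le> m \<and> c_sum lam m \<le> k)"
  have "1 \<le> length lam"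
  proof (rule ccontr)
    assume "\<not> 1 \<le> length lam"
    then have "ev_sum lam = 0"
      by (auto simp: ev_sum_def c_sum_def)
    with assms show False
      by simp
  qed
  then have "1 \<le> length lam \<and> c_sum lam (length lam) \<le> k"
    by (simp add: c_sum_length)
  then have m: "1 \<le> m \<and> c_sum lam m \<le> k"
    unfolding m_def by (rule LeastI)
  have "m \<noteq> 1"
    using m assms by (auto simp: ev_sum_def)
  define l where "l = m - 1"
  have l: "m = l + 1" "1 \<le> l"
    using m \<open>m \<noteq> 1\<close> by (auto simp: l_def)
  have "\<not> (1 \<le> l \<and> c_sum lam l \<le> k)"
    using not_less_Least [of l "\<lambda>m. 1 \<le> m \<and> c_sum lam m \<le> k"] l m_def by simp
  then show ?thesis
    using l m by (auto simp: J_set_def intro!: exI [of _ l])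
qed

text \<open>
  \<open>C_coeff lam k\<close> is \<open>C(n,\<lambda>;k)\<close>, meaningful for \<open>k \<le> |\<lambda>|\<close>. Subtraction on \<open>nat\<close> is harmless in the
  summation bounds: \<open>k - \<lambda>\<^sub>1 + \<lambda>\<^sub>2\<close> only occurs in a maximum with \<open>ev\<^sub>\<lambda> \<ge> 0\<close>, and
  \<open>od\<^sub>\<lambda> \<ge> \<lambda>\<^sub>1\<close>.
\<close>

function C_coeff :: "nat list \<Rightarrow> nat \<Rightarrow> int" where
  "C_coeff lam k =
     (if length lam \<le> 2 then 1
      else if k \<in> J_set lam 0 then
        (\<Sum>i = max (ev_sum lam) (k + part lam 2 - part lam 1)
             ..min k (od_sum lam + part lam 2 - part lam 1). C_coeff (drop 1 lam) i)
      else if k < ev_sum lam then C_coeff (drop (LEAST l. 1 \<le> l \<and> k \<in> J_set lam l) lam) k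
      else C_coeff lam (sum_list lam - k))"
  by pat_completeness auto
termination
proof (relation "measures [\<lambda>(lam, k). length lam,
    \<lambda>(lam, k). if k \<in> J_set lam 0 \<or> k < ev_sum lam then 0 else 1]", goal_cases)
  case 1
  then show ?case
    by simp
next
  case (2 lam k i)
  then show ?case
    by simp
next
  case (3 lam k)
  then have "1 \<le> (LEAST l. 1 \<le> l \<and> k \<in> J_set lam l)"
    using LeastI_ex [OF ex_index_below_ev [of k lam]] by simp
  with 3 show ?case
    by simp
next
  case (4 lam k)
  have "sum_list lam = od_sum lam + ev_sum lam"
    using c_sum_0_plus_1 [of lam] by (simp add: od_sum_def ev_sum_def)
  with 4 show ?case
    by (auto simp: J_set_def ev_sum_def od_sum_def)
qed

declare C_coeff.simps [simp del]

definition unimodal_on :: "(nat \<Rightarrow> int) \<Rightarrow> nat set \<Rightarrow> bool" where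
  "unimodal_on f I \<longleftrightarrow>
     (\<exists>m\<in>I. mono_on {k\<in>I. k \<le> m} f \<and> antimono_on {k\<in>I. m \<le> k} f)"

end

theory Submission
  imports Defs "HOL-Combinatorics.List_Permutation"
begin

text \<open>
  Write \<open>\<lambda> = (a, \<mu>)\<close> with \<open>a\<close> the largest part. A subgroup of \<open>\<int>/p\<^sup>a \<oplus> G\<^sub>\<mu>\<close> either has its first
  coordinates in \<open>p\<int>/p\<^sup>a\<close>, or it contains some \<open>(1, x)\<close>; in the latter case it is the preimage of a subgroup
  of \<open>G\<^sub>\<mu>\<close> under \<open>(i, y) \<mapsto> y - i x\<close>. This gives
  \<open>N\<^sub>r(a, \<mu>) = N\<^sub>r(a-1, \<mu>) + p\<^bsup>a+|\<mu>|-r\<^esup> N\<^bsub>r-a\<^esub>(\<mu>)\<close>, from which the dual recursion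
  \<open>N\<^sub>r(a, \<mu>) = N\<^bsub>r-1\<^esub>(a-1, \<mu>) + p\<^sup>r N\<^sub>r(\<mu>)\<close> follows formally. Subtracting the two eliminates the partition
  \<open>(a-1, \<mu>)\<close> and expresses \<open>N\<^sub>k(\<lambda>)\<close> by the polynomials of \<open>\<mu>\<close> alone:
  \<open>N\<^sub>k(\<lambda>) = \<Sum>\<^bsub>i\<le>k\<^esub> p\<^sup>i N\<^sub>i(\<mu>) - \<Sum>\<^bsub>i<k-a\<^esub> p\<^bsup>|\<mu>|-i\<^esup> N\<^sub>i(\<mu>)\<close>.
  For \<open>k < ev\<^sub>\<lambda>\<close> the summand \<open>i = k\<close> dominates. For \<open>k \<in> J\<^sub>0(\<lambda>)\<close> the degree of \<open>p\<^sup>i N\<^sub>i(\<mu>)\<close> is maximal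
  exactly for \<open>i \<in> J\<^sub>-\<^sub>1(\<mu>)\<close>, and after cancellation the leading coefficients of these summands add up to
  \<open>C(n,\<lambda>;k)\<close>.
\<close>

section \<open>Subgroups of a product with a cyclic group\<close>

definition num_sub :: "('a, 'b) monoid_scheme \<Rightarrow> nat \<Rightarrow> nat" where
  "num_sub G m = card {H. subgroup H G \<and> card H = m}"

lemma finite_subgroups: "finite (carrier G) \<Longrightarrow> finite {H. subgroup H G \<and> P H}"
  by (rule finite_subset [of _ "Pow (carrier G)"]) (auto dest: subgroup.subset)

lemma (in group_hom) subgroup_preimage:
  assumes "subgroup L H" shows "subgroup {x \<in> carrier G. h x \<in> L} G"
proof (rule G.subgroupI)
  show "{x \<in> carrier G. h x \<in> L} \<noteq> {}"
    using subgroup.one_closed [OF assms] by (auto intro!: exI [of _ "\<one>\<^bsub>G\<^esub>"])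
qed (use assms in \<open>auto simp: subgroup.m_closed subgroup.m_inv_closed\<close>)

lemma (in group_hom) card_subgroups_of_image:
  assumes "inj_on h (carrier G)"
  shows "card {L. subgroup L H \<and> L \<subseteq> h ` carrier G \<and> card L = m} = num_sub G m"
proof -
  have "bij_betw ((`) h) {K. subgroup K G \<and> card K = m}
          {L. subgroup L H \<and> L \<subseteq> h ` carrier G \<and> card L = m}"
  proof (rule bij_betw_imageI)
    have "K = K'" if "subgroup K G" "subgroup K' G" "h ` K = h ` K'" for K K'
      using inj_on_image_eq_iff [OF assms subgroup.subset subgroup.subset, of K K'] that by blast
    then show "inj_on ((`) h) {K. subgroup K G \<and> card K = m}"
      by (intro inj_onI) simp
    show "(`) h ` {K. subgroup K G \<and> card K = m} =
        {L. subgroup L H \<and> L \<subseteq> h ` carrier G \<and> card L = m}" (is "?A = ?B")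
    proof
      show "?A \<subseteq> ?B"
      proof clarify
        fix K assume K: "subgroup K G"
        then have "K \<subseteq> carrier G" by (rule subgroup.subset)
        moreover from this have "card (h ` K) = card K"
          using assms by (meson card_image inj_on_subset)
        ultimately show "subgroup (h ` K) H \<and> h ` K \<subseteq> h ` carrier G \<and> card (h ` K) = card K"
          using subgroup_img_is_subgroup [OF K] by auto
      qed
      show "?B \<subseteq> ?A"
      proof clarify
        fix L assume L: "subgroup L H" "L \<subseteq> h ` carrier G"
        let ?K = "{x \<in> carrier G. h x \<in> L}"
        have im: "h ` ?K = L" using L by auto
        have "card (h ` ?K) = card ?K"
          using assms by (intro card_image) (auto intro: inj_on_subset)
        then show "L \<in> (`) h ` {K. subgroup K G \<and> card K = card L}"
          using subgroup_preimage [OF L(1)] im by (intro image_eqI [of _ _ ?K]) auto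
      qed
    qed
  qed
  then show ?thesis
    unfolding num_sub_def by (rule bij_betw_same_card [symmetric])
qed

lemma num_sub_iso:
  assumes "group G" "group H" "f \<in> iso G H"
  shows "num_sub G m = num_sub H m"
proof -
  interpret group_hom G H f
    using assms by (simp add: group_hom_def group_hom_axioms_def iso_def)
  have "num_sub G m = card {L. subgroup L H \<and> L \<subseteq> f ` carrier G \<and> card L = m}"
    using assms by (intro card_subgroups_of_image [symmetric]) (auto simp: iso_def bij_betw_def)
  also have "{L. subgroup L H \<and> L \<subseteq> f ` carrier G \<and> card L = m} = {L. subgroup L H \<and> card L = m}"
    using assms by (auto simp: iso_def bij_betw_def dest: subgroup.subset)
  finally show ?thesis by (simp add: num_sub_def)
qed

section \<open>Subgroups of a cyclic group times \<open>G\<close> that contain some (1, x)\<close>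

abbreviation cyc :: "nat \<Rightarrow> int monoid" where "cyc \<equiv> integer_mod_group"

text \<open>This makes the map from i to x^i well defined on \<open>cyc q\<close> when the order of
  \<open>x\<close> divides \<open>q\<close>.\<close>

lemma (in group) int_pow_mod:
  assumes "x \<in> carrier G" "x [^] (q::nat) = \<one>"
  shows "x [^] (i mod int q) = x [^] i"
proof -
  have "x [^] i = x [^] (int q * (i div int q) + i mod int q)" by simp
  also have "\<dots> = x [^] (int q * (i div int q)) \<otimes> x [^] (i mod int q)"
    using assms(1) by (rule int_pow_mult)
  also have "x [^] (int q * (i div int q)) = (x [^] int q) [^] (i div int q)"
    using assms(1) by (rule int_pow_pow [symmetric])
  also have "x [^] int q = \<one>" using assms by (simp add: int_pow_int)
  finally show ?thesis using assms by simp
qed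

text \<open>The assumption \<open>expo\<close> is where the maximality of the first part will enter:
  it turns i \<mapsto> x^i into a homomorphism from \<open>cyc q\<close> to \<open>G\<close> for
  every \<open>x\<close>.\<close>

locale cyclic_times = comm_group G for G (structure) +
  fixes p a q :: nat
  assumes prime: "Factorial_Ring.prime p" and a: "a \<ge> 1" and q: "q = p ^ a"
    and fin: "finite (carrier G)"
    and expo: "x \<in> carrier G \<Longrightarrow> x [^] q = \<one>"
begin

lemma q0: "q > 0" using prime q by (simp add: prime_gt_0_nat)
lemma q1: "q > 1" unfolding q using prime a by (intro one_less_power) (auto simp: prime_gt_Suc_0_nat)

lemma carrier_cyc: "carrier (cyc q) = {0..<int q}" using q0 by (simp add: carrier_integer_mod_group)

lemma group_prod: "group (cyc q \<times>\<times> G)"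
  by (simp add: DirProd_group is_group)

lemma fin_prod: "finite (carrier (cyc q \<times>\<times> G))"
  by (simp add: fin carrier_cyc)

text \<open>Additively (i, y) \<mapsto> y - i x. For \<open>x\<close> in \<open>G\<close> the kernel
  is generated by (1, x), so the preimages of subgroups are exactly the subgroups containing (1,
  x).\<close>

definition shear :: "'a \<Rightarrow> int \<times> 'a \<Rightarrow> 'a" where
  "shear x = (\<lambda>(i, y). y \<otimes> x [^] (- i))"

lemma shear_hom: "x \<in> carrier G \<Longrightarrow> group_hom (cyc q \<times>\<times> G) G (shear x)"
proof (intro group_hom.intro group_hom_axioms.intro group_prod is_group)
  assume x: "x \<in> carrier G"
  show "shear x \<in> hom (cyc q \<times>\<times> G) G"
  proof (rule homI; clarsimp simp: shear_def x)
    fix i y j z assume yz: "y \<in> carrier G" "z \<in> carrier G"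
    have "x [^] (- ((i + j) mod int q)) = inv (x [^] ((i + j) mod int q))"
      using x by (rule int_pow_neg)
    also have "\<dots> = inv (x [^] (i + j))" using x expo by (simp add: int_pow_mod)
    also have "\<dots> = x [^] (- i) \<otimes> x [^] (- j)"
      using x by (simp add: int_pow_mult int_pow_neg inv_mult)
    finally show "y \<otimes> z \<otimes> x [^] (- ((i + j) mod int q)) =
       y \<otimes> x [^] (- i) \<otimes> (z \<otimes> x [^] (- j))"
      using x yz by (simp add: m_ac)
  qed
qed

definition lift_subgroup :: "'a \<Rightarrow> 'a set \<Rightarrow> (int \<times> 'a) set" where
  "lift_subgroup x L = {u \<in> carrier (cyc q \<times>\<times> G). shear x u \<in> L}"

lemma subgroup_lift_subgroup: "x \<in> carrier G \<Longrightarrow> subgroup L G \<Longrightarrow> subgroup (lift_subgroup x L) (cyc q \<times>\<times> G)"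
  unfolding lift_subgroup_def by (rule group_hom.subgroup_preimage [OF shear_hom])

text \<open>Over each first coordinate i lies the translate of \<open>L\<close> by x^i, so the lift
  consists of \<open>q\<close> disjoint copies of \<open>L\<close>.\<close>

lemma card_lift_subgroup:
  assumes "x \<in> carrier G" "subgroup L G"
  shows "card (lift_subgroup x L) = q * card L"
proof -
  have sub: "L \<subseteq> carrier G" using assms subgroup.subset by blast
  have cancel: "l \<otimes> x [^] i \<otimes> x [^] (- i) = l" "l \<otimes> x [^] (- i) \<otimes> x [^] i = l"
    if "l \<in> carrier G" for l and i :: int
    using that assms(1) int_pow_mult [OF assms(1), of i "- i"] int_pow_mult [OF assms(1), of "- i" i]
    by (simp_all add: m_assoc)
  have mem: "u \<in> lift_subgroup x L \<longleftrightarrow> fst u \<in> {0..<int q} \<and> snd u \<in> carrier G \<and> snd u \<otimes> x [^] (- fst u) \<in> L" for u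
    by (cases u) (simp add: lift_subgroup_def carrier_cyc shear_def)
  have "bij_betw (\<lambda>u. (fst u, snd u \<otimes> x [^] fst u)) ({0..<int q} \<times> L) (lift_subgroup x L)"
  proof (rule bij_betw_byWitness [of _ "\<lambda>u. (fst u, snd u \<otimes> x [^] (- fst u))"])
    show "\<forall>u\<in>{0..<int q} \<times> L. (fst (fst u, snd u \<otimes> x [^] fst u), snd (fst u, snd u \<otimes> x [^] fst u) \<otimes> x [^] (- fst (fst u, snd u \<otimes> x [^] fst u))) = u"
      using sub by (force simp: cancel)
    show "\<forall>u\<in>lift_subgroup x L. (fst (fst u, snd u \<otimes> x [^] (- fst u)), snd (fst u, snd u \<otimes> x [^] (- fst u)) \<otimes> x [^] fst (fst u, snd u \<otimes> x [^] (- fst u))) = u"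
      by (simp add: mem cancel)
    show "(\<lambda>u. (fst u, snd u \<otimes> x [^] fst u)) ` ({0..<int q} \<times> L) \<subseteq> lift_subgroup x L"
    proof
      fix v assume "v \<in> (\<lambda>u. (fst u, snd u \<otimes> x [^] fst u)) ` ({0..<int q} \<times> L)"
      then obtain i l where v: "v = (i, l \<otimes> x [^] i)" "i \<in> {0..<int q}" "l \<in> L" by auto
      then have "l \<in> carrier G" using sub by auto
      with v assms(1) show "v \<in> lift_subgroup x L" by (simp add: mem cancel)
    qed
    show "(\<lambda>u. (fst u, snd u \<otimes> x [^] (- fst u))) ` lift_subgroup x L \<subseteq> {0..<int q} \<times> L"
      by (simp add: mem image_subset_iff)
  qed
  then have "card (lift_subgroup x L) = card ({0..<int q} \<times> L)"
    by (rule bij_betw_same_card [symmetric])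
  then show ?thesis by (simp add: card_cartesian_product)
qed

lemma mem_lift_subgroup_one: "x \<in> carrier G \<Longrightarrow> subgroup L G \<Longrightarrow> (1, y) \<in> lift_subgroup x L \<longleftrightarrow> y \<in> carrier G \<and> y \<otimes> inv x \<in> L"
  using q1 by (auto simp: lift_subgroup_def carrier_cyc shear_def int_pow_neg)

lemma one_mem_lift_subgroup: "x \<in> carrier G \<Longrightarrow> subgroup L G \<Longrightarrow> (1, x) \<in> lift_subgroup x L"
  by (simp add: mem_lift_subgroup_one subgroup.one_closed)

text \<open>For \<open>H\<close> containing (1, x) this is the subgroup of which \<open>H\<close> is
  the lift along \<open>x\<close>.\<close>

definition zero_fibre :: "(int \<times> 'a) set \<Rightarrow> 'a set" where
  "zero_fibre H = {y. (0, y) \<in> H}"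

lemma zero_fibre_lift_subgroup: "x \<in> carrier G \<Longrightarrow> subgroup L G \<Longrightarrow> zero_fibre (lift_subgroup x L) = L"
  using q0 by (auto simp: zero_fibre_def lift_subgroup_def carrier_cyc shear_def dest: subgroup.mem_carrier)

lemma pow_pair:
  assumes "i \<in> carrier (cyc q)" "y \<in> carrier G"
  shows "(i, y) [^]\<^bsub>cyc q \<times>\<times> G\<^esub> (n::nat) = ((int n * i) mod int q, y [^] n)"
proof (induction n)
  case 0 show ?case by simp
next
  case (Suc n)
  then show ?case using assms by (simp add: mod_add_left_eq mod_add_right_eq algebra_simps)
qed

lemma zero_fibre_subgroup:
  assumes "subgroup H (cyc q \<times>\<times> G)" shows "subgroup (zero_fibre H) G"
proof -
  interpret H: subgroup H "cyc q \<times>\<times> G" by fact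
  interpret P: group "cyc q \<times>\<times> G" by (rule group_prod)
  show ?thesis
  proof (rule subgroupI)
    show "zero_fibre H \<subseteq> carrier G" using H.subset by (auto simp: zero_fibre_def)
    show "zero_fibre H \<noteq> {}" using H.one_closed by (auto simp: zero_fibre_def)
    fix y assume y: "y \<in> zero_fibre H"
    then have yH: "(0, y) \<in> H" and yc: "y \<in> carrier G" using H.subset by (auto simp: zero_fibre_def)
    from H.m_inv_closed [OF yH] show "inv y \<in> zero_fibre H"
      using yc by (simp add: zero_fibre_def inv_DirProd [OF group_integer_mod_group is_group])
    fix z assume z: "z \<in> zero_fibre H"
    then have zH: "(0, z) \<in> H" by (auto simp: zero_fibre_def)
    from H.m_closed [OF yH zH] show "y \<otimes> z \<in> zero_fibre H" by (simp add: zero_fibre_def)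
  qed
qed

text \<open>Since \<open>H\<close> contains all (i, x^i), membership of (i, y) amounts to that of
  (0, y x^(-i)). Thus \<open>H\<close> is determined by its zero fibre and any one such
  \<open>x\<close>.\<close>

lemma lift_subgroup_zero_fibre:
  assumes H: "subgroup H (cyc q \<times>\<times> G)" and x: "(1, x) \<in> H"
  shows "lift_subgroup x (zero_fibre H) = H"
proof -
  interpret H: subgroup H "cyc q \<times>\<times> G" by fact
  interpret P: group "cyc q \<times>\<times> G" by (rule group_prod)
  have xc: "x \<in> carrier G" using H.subset x by auto
  have pw: "(i, x [^] i) \<in> H" if i: "i \<in> {0..<int q}" for i
  proof -
    have "(1, x) [^]\<^bsub>cyc q \<times>\<times> G\<^esub> (nat i) \<in> H"
      using P.subgroup_int_pow_closed [OF H x, of i] i by simp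
    moreover have "(1, x) [^]\<^bsub>cyc q \<times>\<times> G\<^esub> (nat i) = ((int (nat i) * 1) mod int q, x [^] nat i)"
      using xc q1 by (intro pow_pair) (auto simp: carrier_cyc)
    moreover have "(int (nat i) * 1) mod int q = i" using i by simp
    moreover have "x [^] nat i = x [^] i" using i by simp
    ultimately show ?thesis by argo
  qed
  have *: "(i, y) \<in> H \<longleftrightarrow> (0, y \<otimes> x [^] (- i)) \<in> H" if i: "i \<in> {0..<int q}" and y: "y \<in> carrier G" for i y
  proof
    assume "(i, y) \<in> H"
    then have "(i, y) \<otimes>\<^bsub>cyc q \<times>\<times> G\<^esub> inv\<^bsub>cyc q \<times>\<times> G\<^esub> (i, x [^] i) \<in> H"
      using pw [OF i] by (meson H.m_closed H.m_inv_closed)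
    moreover have "inv\<^bsub>cyc q \<times>\<times> G\<^esub> (i, x [^] i) = (- i mod int q, x [^] (- i))"
      using i xc by (simp add: inv_DirProd [OF group_integer_mod_group is_group] carrier_cyc int_pow_neg)
    ultimately show "(0, y \<otimes> x [^] (- i)) \<in> H"
      by (simp add: mod_add_right_eq)
  next
    assume "(0, y \<otimes> x [^] (- i)) \<in> H"
    from H.m_closed [OF this pw [OF i]] show "(i, y) \<in> H"
      using i xc y by (simp add: m_assoc int_pow_mult [symmetric])
  qed
  have "lift_subgroup x (zero_fibre H) = {u \<in> carrier (cyc q \<times>\<times> G). u \<in> H}"
    unfolding lift_subgroup_def zero_fibre_def shear_def by (rule Collect_cong) (auto simp: carrier_cyc *[symmetric])
  then show ?thesis using H.subset by auto
qed


lemma card_top_eq: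
  assumes H: "subgroup H (cyc q \<times>\<times> G)" and x: "(1, x) \<in> H"
  shows "card H = q * card (zero_fibre H)"
proof -
  have "x \<in> carrier G" using subgroup.subset [OF H] x by auto
  then show ?thesis
    using card_lift_subgroup [OF _ zero_fibre_subgroup [OF H], of x] lift_subgroup_zero_fibre [OF H x] by simp
qed

text \<open>The set on the left is a coset of the zero fibre; its size tells from how many
  \<open>x\<close> the same \<open>H\<close> arises as a lift.\<close>

lemma card_fibre:
  assumes H: "subgroup H (cyc q \<times>\<times> G)" and x: "(1, x) \<in> H"
  shows "card {y. (1, y) \<in> H} = card (zero_fibre H)"
proof -
  have xc: "x \<in> carrier G" using subgroup.subset [OF H] x by auto
  have ks: "zero_fibre H \<subseteq> carrier G" using zero_fibre_subgroup [OF H] by (rule subgroup.subset)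
  have mem: "(1, y) \<in> H \<longleftrightarrow> y \<in> carrier G \<and> y \<otimes> inv x \<in> zero_fibre H" for y
    using mem_lift_subgroup_one [OF xc zero_fibre_subgroup [OF H], of y] lift_subgroup_zero_fibre [OF H x] by simp
  have "{y. (1, y) \<in> H} = (\<lambda>l. l \<otimes> x) ` zero_fibre H"
  proof (intro equalityI subsetI)
    fix y assume "y \<in> {y. (1, y) \<in> H}"
    then have "y \<in> carrier G" "y \<otimes> inv x \<in> zero_fibre H" using mem by auto
    then show "y \<in> (\<lambda>l. l \<otimes> x) ` zero_fibre H"
      using xc by (intro image_eqI [of _ _ "y \<otimes> inv x"]) (simp_all add: m_assoc)
  next
    fix y assume "y \<in> (\<lambda>l. l \<otimes> x) ` zero_fibre H"
    then obtain l where l: "l \<in> zero_fibre H" "y = l \<otimes> x" by auto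
    then have "l \<in> carrier G" using ks by auto
    with l xc show "y \<in> {y. (1, y) \<in> H}" by (simp add: mem m_assoc)
  qed
  moreover have "inj_on (\<lambda>l. l \<otimes> x) (zero_fibre H)"
    using ks xc by (intro inj_onI) (use right_cancel in blast)
  ultimately show ?thesis by (simp add: card_image)
qed

text \<open>Both sides count the pairs of such a subgroup \<open>H\<close> and an \<open>x\<close> with \<open>(1, x) \<in> H\<close>.\<close>

lemma card_top_subgroups:
  assumes "c > 0"
  shows "card {H. subgroup H (cyc q \<times>\<times> G) \<and> (\<exists>x. (1, x) \<in> H) \<and> card H = q * c} * c
    = card (carrier G) * num_sub G c"
proof -
  define A where "A = {H. subgroup H (cyc q \<times>\<times> G) \<and> (\<exists>x. (1, x) \<in> H) \<and> card H = q * c}"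
  define B where "B = {L. subgroup L G \<and> card L = c}"
  have fA: "finite A" unfolding A_def using finite_subgroups [OF fin_prod] by simp
  have fib: "finite {y. (1, y) \<in> H} \<and> card {y. (1, y) \<in> H} = c" if "H \<in> A" for H
  proof -
    from that obtain x where H: "subgroup H (cyc q \<times>\<times> G)" "(1, x) \<in> H" "card H = q * c"
      by (auto simp: A_def)
    then have "card (zero_fibre H) = c" using card_top_eq [of H x] q0 by simp
    then have "card {y. (1, y) \<in> H} = c" using card_fibre [OF H(1,2)] by simp
    then show ?thesis using assms card_ge_0_finite by auto
  qed
  have "bij_betw (\<lambda>(x, L). (lift_subgroup x L, x)) (carrier G \<times> B) (SIGMA H:A. {y. (1, y) \<in> H})"
  proof (rule bij_betw_byWitness [of _ "\<lambda>(H, x). (x, zero_fibre H)"])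
    show "\<forall>u\<in>carrier G \<times> B. (case case u of (x, L) \<Rightarrow> (lift_subgroup x L, x) of (H, x) \<Rightarrow> (x, zero_fibre H)) = u"
      by (auto simp: B_def zero_fibre_lift_subgroup)
    show "\<forall>u\<in>SIGMA H:A. {y. (1, y) \<in> H}. (case case u of (H, x) \<Rightarrow> (x, zero_fibre H) of (x, L) \<Rightarrow> (lift_subgroup x L, x)) = u"
      by (auto simp: A_def lift_subgroup_zero_fibre)
    show "(\<lambda>(x, L). (lift_subgroup x L, x)) ` (carrier G \<times> B) \<subseteq> (SIGMA H:A. {y. (1, y) \<in> H})"
      using one_mem_lift_subgroup by (auto simp: A_def B_def card_lift_subgroup subgroup_lift_subgroup)
    have "x \<in> carrier G \<and> zero_fibre H \<in> B" if "H \<in> A" "(1, x) \<in> H" for H x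
    proof
      have H: "subgroup H (cyc q \<times>\<times> G)" "card H = q * c" using that by (auto simp: A_def)
      show "x \<in> carrier G" using subgroup.subset [OF H(1)] that by auto
      show "zero_fibre H \<in> B" using card_top_eq [OF H(1) that(2)] H q0 zero_fibre_subgroup by (simp add: B_def)
    qed
    then show "(\<lambda>(H, x). (x, zero_fibre H)) ` (SIGMA H:A. {y. (1, y) \<in> H}) \<subseteq> carrier G \<times> B"
      by auto
  qed
  then have "card (carrier G \<times> B) = card (SIGMA H:A. {y. (1, y) \<in> H})"
    by (rule bij_betw_same_card)
  also have "\<dots> = (\<Sum>H\<in>A. card {y. (1, y) \<in> H})"
    using fA fib by (intro card_SigmaI) auto
  also have "\<dots> = card A * c" using fib by simp
  finally show ?thesis by (simp add: card_cartesian_product A_def B_def num_sub_def)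
qed

section \<open>Separation of the subgroups by their first coordinates\<close>

lemma exists_one_mem:
  assumes H: "subgroup H (cyc q \<times>\<times> G)" and ix: "(i, x) \<in> H" and i: "\<not> int p dvd i"
  shows "\<exists>y. (1, y) \<in> H"
proof -
  interpret P: group "cyc q \<times>\<times> G" by (rule group_prod)
  have c: "i \<in> carrier (cyc q)" "x \<in> carrier G" using subgroup.subset [OF H] ix by auto
  \<comment> \<open>An i prime to p is invertible modulo p^a, and the multiple of (i, x) by an
    inverse has first coordinate 1.\<close>
  have "coprime (int p) i" using prime i by (simp add: prime_imp_coprime)
  then have "coprime (int q) i" by (simp add: q)
  then have "coprime i (int q)" by (simp add: coprime_commute)
  then obtain u where "(i * u) mod int q = 1 mod int q"
    by (metis bezout_int coprime_imp_gcd_eq_1 mod_mult_self3 mult.commute add.commute)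
  then have u: "(int (nat (u mod int q)) * i) mod int q = 1"
    using q1 by (simp add: mult.commute mod_mult_right_eq)
  have "(i, x) [^]\<^bsub>cyc q \<times>\<times> G\<^esub> nat (u mod int q) \<in> H"
    using P.subgroup_int_pow_closed [OF H ix, of "u mod int q"] q1 by simp
  then show ?thesis unfolding pow_pair [OF c] u by blast
qed

text \<open>Embeds Z/p^(a-1) onto the multiples of p in Z/p^a, so that subgroups without an element
  (1, x) are counted in a product with a smaller first factor.\<close>

definition shrink :: "int \<times> 'a \<Rightarrow> int \<times> 'a" where
  "shrink = (\<lambda>(i, y). (int p * i, y))"

lemma q_Suc: "int q = int p * int (p ^ (a - 1))"
  using a by (simp add: q power_eq_if)

lemma carrier_cyc_pred: "carrier (cyc (p ^ (a - 1))) = {0..<int (p ^ (a - 1))}"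
  using prime by (simp add: carrier_integer_mod_group prime_gt_0_nat)

lemma shrink_hom: "group_hom (cyc (p ^ (a - 1)) \<times>\<times> G) (cyc q \<times>\<times> G) shrink"
proof (intro group_hom.intro group_hom_axioms.intro group_prod)
  show "group (cyc (p ^ (a - 1)) \<times>\<times> G)" by (simp add: DirProd_group is_group)
  have p0: "p > 0" using prime by (simp add: prime_gt_0_nat)
  show "shrink \<in> hom (cyc (p ^ (a - 1)) \<times>\<times> G) (cyc q \<times>\<times> G)"
  proof (rule homI)
    fix u assume "u \<in> carrier (cyc (p ^ (a - 1)) \<times>\<times> G)"
    then show "shrink u \<in> carrier (cyc q \<times>\<times> G)"
      using p0 unfolding carrier_DirProd carrier_cyc carrier_cyc_pred q_Suc by (auto simp: shrink_def)
  next
    fix u v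
    show "shrink (u \<otimes>\<^bsub>cyc (p ^ (a - 1)) \<times>\<times> G\<^esub> v) = shrink u \<otimes>\<^bsub>cyc q \<times>\<times> G\<^esub> shrink v"
      unfolding mult_DirProd' mult_integer_mod_group q_Suc
      by (simp add: shrink_def case_prod_beta mult_mod_right distrib_left)
  qed
qed

lemma shrink_image:
  "shrink ` carrier (cyc (p ^ (a - 1)) \<times>\<times> G) = {u \<in> carrier (cyc q \<times>\<times> G). int p dvd fst u}"
proof (intro equalityI subsetI)
  interpret group_hom "cyc (p ^ (a - 1)) \<times>\<times> G" "cyc q \<times>\<times> G" shrink by (rule shrink_hom)
  fix v assume "v \<in> shrink ` carrier (cyc (p ^ (a - 1)) \<times>\<times> G)"
  then obtain u where u: "v = shrink u" "u \<in> carrier (cyc (p ^ (a - 1)) \<times>\<times> G)" by blast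
  then have "v \<in> carrier (cyc q \<times>\<times> G)" using hom_closed by simp
  moreover have "int p dvd fst v" using u by (simp add: shrink_def case_prod_beta)
  ultimately show "v \<in> {u \<in> carrier (cyc q \<times>\<times> G). int p dvd fst u}" by blast
next
  fix v assume v: "v \<in> {u \<in> carrier (cyc q \<times>\<times> G). int p dvd fst u}"
  then obtain i where i: "fst v = int p * i" by blast
  have p0: "int p > 0" using prime by (simp add: prime_gt_0_nat)
  from v have "0 \<le> int p * i" "int p * i < int p * int (p ^ (a - 1))" "snd v \<in> carrier G"
    using i by (auto simp: carrier_cyc q_Suc mem_Times_iff)
  then have "0 \<le> i" "i < int (p ^ (a - 1))" using p0 by (simp_all add: zero_le_mult_iff del: of_nat_power)
  with \<open>snd v \<in> carrier G\<close> have "(i, snd v) \<in> carrier (cyc (p ^ (a - 1)) \<times>\<times> G)"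
    unfolding carrier_DirProd carrier_cyc_pred by simp
  moreover have "v = shrink (i, snd v)" using i by (simp add: shrink_def prod_eq_iff)
  ultimately show "v \<in> shrink ` carrier (cyc (p ^ (a - 1)) \<times>\<times> G)" by blast
qed

lemma inj_shrink: "inj_on shrink X"
  using prime by (auto intro!: inj_onI simp: shrink_def)

text \<open>By \<open>exists_one_mem\<close> a subgroup has no element (1, x) exactly when p divides
  all its first coordinates, that is, when it lies in the image of \<open>shrink\<close>.\<close>

lemma num_sub_split:
  "num_sub (cyc q \<times>\<times> G) m = num_sub (cyc (p ^ (a - 1)) \<times>\<times> G) m
    + card {H. subgroup H (cyc q \<times>\<times> G) \<and> (\<exists>x. (1, x) \<in> H) \<and> card H = m}"
proof -
  let ?M = "shrink ` carrier (cyc (p ^ (a - 1)) \<times>\<times> G)"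
  let ?A = "{H. subgroup H (cyc q \<times>\<times> G) \<and> H \<subseteq> ?M \<and> card H = m}"
  let ?B = "{H. subgroup H (cyc q \<times>\<times> G) \<and> (\<exists>x. (1, x) \<in> H) \<and> card H = m}"
  have p1: "\<not> int p dvd 1" using prime not_prime_unit zdvd1_eq by fastforce
  have "H \<subseteq> ?M \<longleftrightarrow> \<not> (\<exists>x. (1, x) \<in> H)" if H: "subgroup H (cyc q \<times>\<times> G)" for H
  proof
    assume "H \<subseteq> ?M"
    then show "\<not> (\<exists>x. (1, x) \<in> H)" using p1 unfolding shrink_image by auto
  next
    assume no: "\<not> (\<exists>x. (1, x) \<in> H)"
    show "H \<subseteq> ?M"
      unfolding shrink_image using exists_one_mem [OF H] no subgroup.subset [OF H] by fastforce
  qed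
  then have eq: "{H. subgroup H (cyc q \<times>\<times> G) \<and> card H = m} = ?A \<union> ?B" and "?A \<inter> ?B = {}"
    by blast+
  moreover have "finite ?A" "finite ?B" using finite_subgroups [OF fin_prod] by auto
  ultimately have "num_sub (cyc q \<times>\<times> G) m = card ?A + card ?B"
    unfolding num_sub_def eq by (intro card_Un_disjoint)
  then show ?thesis
    using group_hom.card_subgroups_of_image [OF shrink_hom inj_shrink] by simp
qed

text \<open>Each subgroup of \<open>G\<close> of order \<open>c\<close> is the zero fibre of |G|/c
  subgroups containing some (1, x); the factor \<open>c\<close> on both sides avoids the
  division.\<close>

lemma num_sub_mult_eq:
  assumes "c > 0"
  shows "num_sub (cyc q \<times>\<times> G) (q * c) * c =
    num_sub (cyc (p ^ (a - 1)) \<times>\<times> G) (q * c) * c + card (carrier G) * num_sub G c"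
  using num_sub_split [of "q * c"] card_top_subgroups [OF assms] by (simp add: add_mult_distrib)

text \<open>A subgroup with an element (1, x) has order \<open>q\<close> times that of its zero
  fibre, so only subgroups of the other kind can have order \<open>m\<close>.\<close>

lemma num_sub_not_dvd:
  assumes "\<not> q dvd m"
  shows "num_sub (cyc q \<times>\<times> G) m = num_sub (cyc (p ^ (a - 1)) \<times>\<times> G) m"
proof -
  have no: "\<not> (subgroup H (cyc q \<times>\<times> G) \<and> (\<exists>x. (1, x) \<in> H) \<and> card H = m)" for H
  proof
    assume "subgroup H (cyc q \<times>\<times> G) \<and> (\<exists>x. (1, x) \<in> H) \<and> card H = m"
    then obtain x where "subgroup H (cyc q \<times>\<times> G)" "(1, x) \<in> H" "card H = m" by blast
    then have "m = q * card (zero_fibre H)" using card_top_eq [of H x] by simp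
    then show False using assms by simp
  qed
  have "{H. subgroup H (cyc q \<times>\<times> G) \<and> (\<exists>x. (1, x) \<in> H) \<and> card H = m} = {}"
    using no by (intro equals0I) (simp only: mem_Collect_eq)
  then have "card {H. subgroup H (cyc q \<times>\<times> G) \<and> (\<exists>x. (1, x) \<in> H) \<and> card H = m} = 0"
    by (simp only: card.empty)
  with num_sub_split [of m] show ?thesis by linarith
qed

end

section \<open>Recursions for the number of subgroups\<close>

lemma num_subgroups_eq: "num_subgroups p lam k = num_sub (G_type p lam) (p ^ k)"
  by (simp add: num_subgroups_def num_sub_def)

section \<open>Direct products of cyclic groups and the order of the parts\<close>

lemma product_group_reindex:
  assumes h: "bij_betw h I J" and eq: "\<And>i. i \<in> I \<Longrightarrow> F i = G (h i)"
  shows "(\<lambda>f. \<lambda>i\<in>I. f (h i)) \<in> iso (product_group J G) (product_group I F)"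
proof (rule isoI)
  have hJ: "h i \<in> J" if "i \<in> I" for i using that h by (auto simp: bij_betw_def)
  show "(\<lambda>f. \<lambda>i\<in>I. f (h i)) \<in> hom (product_group J G) (product_group I F)"
  proof (rule homI)
    fix x assume "x \<in> carrier (product_group J G)"
    then show "(\<lambda>i\<in>I. x (h i)) \<in> carrier (product_group I F)"
      using hJ by (auto simp: eq)
  next
    fix x y
    show "(\<lambda>i\<in>I. (x \<otimes>\<^bsub>product_group J G\<^esub> y) (h i)) =
      (\<lambda>i\<in>I. x (h i)) \<otimes>\<^bsub>product_group I F\<^esub> (\<lambda>i\<in>I. y (h i))"
      using hJ by (auto simp: eq fun_eq_iff)
  qed
  let ?g = "the_inv_into I h"
  have g: "?g j \<in> I" "h (?g j) = j" if "j \<in> J" for j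
    using h that f_the_inv_into_f_bij_betw [OF h] bij_betw_the_inv_into [OF h]
    by (auto simp: bij_betw_def)
  have gh: "?g (h i) = i" if "i \<in> I" for i
    using h that by (simp add: bij_betw_def the_inv_into_f_f)
  show "bij_betw (\<lambda>f. \<lambda>i\<in>I. f (h i)) (carrier (product_group J G)) (carrier (product_group I F))"
  proof (rule bij_betw_byWitness [of _ "\<lambda>f. \<lambda>j\<in>J. f (?g j)"])
    show "\<forall>f\<in>carrier (product_group J G). (\<lambda>j\<in>J. (\<lambda>i\<in>I. f (h i)) (?g j)) = f"
      using g by (auto simp: fun_eq_iff PiE_iff extensional_def)
    show "\<forall>f\<in>carrier (product_group I F). (\<lambda>i\<in>I. (\<lambda>j\<in>J. f (?g j)) (h i)) = f"
      using hJ gh by (auto simp: fun_eq_iff PiE_iff extensional_def)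
    show "(\<lambda>f. \<lambda>i\<in>I. f (h i)) ` carrier (product_group J G) \<subseteq> carrier (product_group I F)"
      using hJ by (auto simp: eq)
    show "(\<lambda>f. \<lambda>j\<in>J. f (?g j)) ` carrier (product_group I F) \<subseteq> carrier (product_group J G)"
      using g eq by (auto simp: PiE_iff) metis
  qed
qed

lemma group_G_type [simp]: "group (G_type p lam)"
  by (simp add: G_type_def)

text \<open>Lowering a part by 1 may leave an unsorted list, while the recursions want a largest
  part in front; permuting the list only reindexes the product.\<close>

lemma num_subgroups_mset:
  assumes "mset xs = mset ys"
  shows "num_subgroups p xs k = num_subgroups p ys k"
proof -
  have len: "length xs = length ys" using assms by (rule mset_eq_length)
  obtain f where f: "bij_betw f {..<length ys} {..<length xs}" "\<forall>i<length ys. ys ! i = xs ! f i"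
    using permutation_Ex_bij [of ys xs] assms by auto
  define h where "h = (\<lambda>i. Suc (f (i - 1)))"
  have "bij_betw (Suc \<circ> (f \<circ> (\<lambda>i. i - 1))) {1..length ys} {1..length xs}"
  proof (intro bij_betw_trans)
    show "bij_betw (\<lambda>i. i - 1) {1..length ys} {..<length ys}"
      by (rule bij_betw_byWitness [of _ Suc]) auto
    show "bij_betw Suc {..<length xs} {1..length xs}"
      by (rule bij_betw_byWitness [of _ "\<lambda>i. i - 1"]) auto
  qed (rule f(1))
  then have "bij_betw h {1..length ys} {1..length xs}"
    by (simp add: h_def comp_def)
  moreover have "part ys i = part xs (h i)" if "i \<in> {1..length ys}" for i
    using f(2) that by (auto simp: part_def h_def)
  ultimately have "(\<lambda>f. \<lambda>i\<in>{1..length ys}. f (h i)) \<in> iso (G_type p xs) (G_type p ys)"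
    unfolding G_type_def by (intro product_group_reindex) auto
  then show ?thesis
    unfolding num_subgroups_eq by (intro num_sub_iso) auto
qed

lemma G_type_Cons:
  "(\<lambda>f. (f 1, \<lambda>i\<in>{1..length xs}. f (Suc i))) \<in> iso (G_type p (x # xs)) (integer_mod_group (p ^ x) \<times>\<times> G_type p xs)"
    (is "?h \<in> iso ?A ?B")
proof (rule isoI)
  let ?n = "length xs"
  have m1: "(1::nat) \<in> {1..Suc ?n}" and mS: "\<And>i. i \<in> {1..?n} \<Longrightarrow> Suc i \<in> {1..Suc ?n}" by auto
  have pS: "part (x # xs) (Suc i) = part xs i" if "i \<in> {1..?n}" for i
    using that by (auto simp: part_def nth_Cons')
  have p1: "part (x # xs) (Suc 0) = x" by (simp add: part_def)
  have cA: "carrier ?A = (\<Pi>\<^sub>E i\<in>{1..Suc ?n}. carrier (integer_mod_group (p ^ part (x # xs) i)))"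
    by (simp add: G_type_def)
  have cB: "carrier ?B = carrier (integer_mod_group (p ^ x)) \<times> (\<Pi>\<^sub>E i\<in>{1..?n}. carrier (integer_mod_group (p ^ part xs i)))"
    by (simp add: G_type_def)
  have into: "?h f \<in> carrier ?B" if "f \<in> carrier ?A" for f
  proof -
    have "f i \<in> carrier (integer_mod_group (p ^ part (x # xs) i))" if "i \<in> {1..Suc ?n}" for i
      using \<open>f \<in> carrier ?A\<close> that unfolding cA by (rule PiE_mem)
    from this [OF m1] this [OF mS] show ?thesis
      unfolding cB using p1 pS by auto
  qed
  show "?h \<in> hom ?A ?B"
  proof (rule homI)
    fix f g
    show "?h (f \<otimes>\<^bsub>?A\<^esub> g) = ?h f \<otimes>\<^bsub>?B\<^esub> ?h g"
      using p1 pS by (auto simp: G_type_def fun_eq_iff)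
  qed (rule into)
  show "bij_betw ?h (carrier ?A) (carrier ?B)"
  proof (rule bij_betw_byWitness [of _ "\<lambda>(z, g). \<lambda>i\<in>{1..Suc ?n}. if i = 1 then z else g (i - 1)"])
    show "\<forall>f\<in>carrier ?A. (case ?h f of (z, g) \<Rightarrow> \<lambda>i\<in>{1..Suc ?n}. if i = 1 then z else g (i - 1)) = f"
      unfolding cA by (auto simp: fun_eq_iff PiE_iff extensional_def)
    show "\<forall>u\<in>carrier ?B. ?h (case u of (z, g) \<Rightarrow> \<lambda>i\<in>{1..Suc ?n}. if i = 1 then z else g (i - 1)) = u"
      unfolding cB by (auto simp: fun_eq_iff PiE_iff extensional_def)
    show "?h ` carrier ?A \<subseteq> carrier ?B" using into by auto
    have "(\<lambda>i\<in>{1..Suc ?n}. if i = 1 then z else g (i - 1)) \<in> carrier ?A"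
      if z: "z \<in> carrier (integer_mod_group (p ^ x))" and
         g: "g \<in> (\<Pi>\<^sub>E i\<in>{1..?n}. carrier (integer_mod_group (p ^ part xs i)))" for z g
      unfolding cA
    proof (rule restrict_PiE_iff [THEN iffD2], intro ballI)
      fix i assume i: "i \<in> {1..Suc ?n}"
      show "(if i = 1 then z else g (i - 1)) \<in> carrier (integer_mod_group (p ^ part (x # xs) i))"
      proof (cases "i = 1")
        case True with z p1 show ?thesis by simp
      next
        case False
        with i have "i - 1 \<in> {1..?n}" "i = Suc (i - 1)" by auto
        with False PiE_mem [OF g, of "i - 1"] pS [of "i - 1"] show ?thesis by simp
      qed
    qed
    then show "(\<lambda>(z, g). \<lambda>i\<in>{1..Suc ?n}. if i = 1 then z else g (i - 1)) ` carrier ?B \<subseteq> carrier ?A"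
      unfolding cB by auto
  qed
qed

lemma num_subgroups_Cons:
  "num_subgroups p (x # xs) k = num_sub (integer_mod_group (p ^ x) \<times>\<times> G_type p xs) (p ^ k)"
  unfolding num_subgroups_eq
  by (rule num_sub_iso [OF _ _ G_type_Cons]) (auto intro: DirProd_group)

lemma
  assumes "p > 0"
  shows finite_G_type: "finite (carrier (G_type p xs))"
    and card_G_type: "card (carrier (G_type p xs)) = p ^ sum_list xs"
proof -
  have "finite (carrier (G_type p xs)) \<and> card (carrier (G_type p xs)) = p ^ sum_list xs"
  proof (induction xs)
    case Nil
    show ?case by (simp add: G_type_def)
  next
    case (Cons x xs)
    have bij: "bij_betw (\<lambda>f. (f 1, \<lambda>i\<in>{1..length xs}. f (Suc i))) (carrier (G_type p (x # xs)))
       (carrier (integer_mod_group (p ^ x) \<times>\<times> G_type p xs))"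
      using G_type_Cons [of xs p x] by (simp add: iso_def)
    have "carrier (integer_mod_group (p ^ x) \<times>\<times> G_type p xs) = {0..<int (p ^ x)} \<times> carrier (G_type p xs)"
      using assms by (simp add: carrier_integer_mod_group)
    then show ?case
      using bij_betw_finite [OF bij] bij_betw_same_card [OF bij] Cons.IH
      by (simp add: card_cartesian_product power_add del: of_nat_power)
  qed
  then show "finite (carrier (G_type p xs))" "card (carrier (G_type p xs)) = p ^ sum_list xs" by auto
qed

lemma comm_group_G_type: "comm_group (G_type p xs)"
  by (rule group.group_comm_groupI [OF group_G_type]) (auto simp: G_type_def fun_eq_iff add.commute)

text \<open>Powers are multiples in each coordinate, and p^a kills every factor. This verifies
  \<open>expo\<close> for lists bounded by \<open>a\<close>.\<close>

lemma pow_G_type: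
  assumes "f \<in> carrier (G_type p xs)" "\<forall>x\<in>set xs. x \<le> a"
  shows "f [^]\<^bsub>G_type p xs\<^esub> (p ^ a :: nat) = \<one>\<^bsub>G_type p xs\<^esub>"
proof -
  have mem: "f i \<in> carrier (integer_mod_group (p ^ part xs i))" if "i \<in> {1..length xs}" for i
    using assms(1) that unfolding G_type_def by (auto dest: PiE_mem)
  have "f [^]\<^bsub>G_type p xs\<^esub> (m::nat) = (\<lambda>i\<in>{1..length xs}. (int m * f i) mod int (p ^ part xs i))" for m
  proof (induction m)
    case 0
    show ?case by (auto simp: G_type_def)
  next
    case (Suc m)
    then show ?case
      by (auto simp: G_type_def fun_eq_iff mod_add_left_eq mod_add_right_eq algebra_simps)
  qed
  moreover have "(int (p ^ a) * f i) mod int (p ^ part xs i) = 0" if "i \<in> {1..length xs}" for i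
  proof -
    have "part xs i \<in> set xs" using that by (auto simp: part_def)
    then have "int (p ^ part xs i) dvd int (p ^ a)"
      using assms(2) le_imp_power_dvd by (metis of_nat_dvd_iff)
    then show ?thesis by (meson dvd_imp_mod_0 dvd_mult2)
  qed
  ultimately show ?thesis by (auto simp: G_type_def fun_eq_iff)
qed

lemma cyclic_times_G_type:
  assumes "Factorial_Ring.prime p" "a \<ge> 1" "\<forall>x\<in>set xs. x \<le> a"
  shows "cyclic_times (G_type p xs) p a (p ^ a)"
  using assms finite_G_type [of p xs] pow_G_type [of _ p xs a]
  by (intro cyclic_times.intro cyclic_times_axioms.intro comm_group_G_type)
     (auto simp: prime_gt_0_nat)

lemma num_subgroups_gt:
  assumes "Factorial_Ring.prime p" "k > sum_list xs"
  shows "num_subgroups p xs k = 0"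
proof -
  have p: "p > 0" "p > 1" using assms(1) prime_gt_1_nat prime_gt_0_nat by auto
  have False if "subgroup H (G_type p xs)" "card H = p ^ k" for H
  proof -
    have "card H \<le> p ^ sum_list xs"
      using card_mono [OF finite_G_type [OF p(1)] subgroup.subset [OF that(1)]] card_G_type [OF p(1)] by simp
    with that assms(2) p(2) show False by simp
  qed
  then have "{H. subgroup H (G_type p xs) \<and> card H = p ^ k} = {}" by blast
  then show ?thesis by (simp only: num_subgroups_def card.empty)
qed

lemma num_subgroups_0: "num_subgroups p xs 0 = 1"
proof -
  interpret group "G_type p xs" by simp
  have "{H. subgroup H (G_type p xs) \<and> card H = p ^ 0} = {{\<one>\<^bsub>G_type p xs\<^esub>}}"
  proof (intro equalityI subsetI)
    fix H assume "H \<in> {H. subgroup H (G_type p xs) \<and> card H = p ^ 0}"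
    then have "subgroup H (G_type p xs)" "card H = 1" by auto
    then show "H \<in> {{\<one>\<^bsub>G_type p xs\<^esub>}}"
      using subgroup.one_closed by (fastforce simp: card_1_singleton_iff)
  qed (use triv_subgroup in auto)
  then show ?thesis by (simp only: num_subgroups_def is_singletonI card.insert finite.emptyI card.empty empty_iff not_False_eq_True One_nat_def)
qed

text \<open>A subgroup of order p^k with an element (1, x) has a zero fibre of order p^(k-a), and
  each such zero fibre occurs |G_xs| / p^(k-a) = p^(a+|xs|-k) times.\<close>

lemma num_subgroups_step:
  assumes "Factorial_Ring.prime p" "a \<ge> 1" "\<forall>x\<in>set xs. x \<le> a" "k \<le> a + sum_list xs"
  shows "num_subgroups p (a # xs) k = num_subgroups p ((a - 1) # xs) k +
     (if k < a then 0 else p ^ (a + sum_list xs - k) * num_subgroups p xs (k - a))"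
proof -
  interpret cyclic_times "G_type p xs" p a "p ^ a" by (rule cyclic_times_G_type [OF assms(1-3)])
  have p: "p > 0" "p > 1" using assms(1) prime_gt_1_nat prime_gt_0_nat by auto
  show ?thesis
  proof (cases "k < a")
    case True
    then have "\<not> p ^ a dvd p ^ k" using p power_dvd_imp_le by fastforce
    then show ?thesis using num_sub_not_dvd True by (simp add: num_subgroups_Cons)
  next
    case False
    have e: "p ^ a * p ^ (k - a) = p ^ k" "p ^ sum_list xs = p ^ (a + sum_list xs - k) * p ^ (k - a)"
      using False assms(4) by (simp_all flip: power_add)
    have "num_subgroups p (a # xs) k * p ^ (k - a) = 
       (num_subgroups p ((a - 1) # xs) k + p ^ (a + sum_list xs - k) * num_subgroups p xs (k - a)) * p ^ (k - a)"
      using num_sub_mult_eq [of "p ^ (k - a)"] p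
      unfolding num_subgroups_Cons num_subgroups_eq [of p xs] by (simp add: e card_G_type algebra_simps)
    then show ?thesis using False p by simp
  qed
qed

section \<open>Recursions, symmetry and summation formula for the counts\<close>

definition pos_partition :: "nat list \<Rightarrow> bool" where
  "pos_partition lam \<longleftrightarrow> sorted_wrt (\<ge>) lam \<and> (\<forall>x\<in>set lam. x > 0)"

lemma pos_partition_Nil [simp]: "pos_partition []"
  by (simp add: pos_partition_def)

lemma pos_partition_Cons: "pos_partition (x # xs) \<longleftrightarrow> x \<ge> 1 \<and> (\<forall>y\<in>set xs. y \<le> x) \<and> pos_partition xs"
  by (auto simp: pos_partition_def)

text \<open>Real values admit exponents of p of either sign, and integer arguments with value 0
  below 0 let the recursions hold for all \<open>r\<close> without range conditions.\<close>

definition N_real :: "nat \<Rightarrow> nat list \<Rightarrow> int \<Rightarrow> real" where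
  "N_real p xs r = (if r < 0 then 0 else real (num_subgroups p xs (nat r)))"

lemma N_real_mset: "mset xs = mset ys \<Longrightarrow> N_real p xs r = N_real p ys r"
  by (simp add: N_real_def num_subgroups_mset [of xs ys])

lemma N_real_outside:
  assumes "Factorial_Ring.prime p" "r < 0 \<or> r > int (sum_list xs)"
  shows "N_real p xs r = 0"
  using assms(2) num_subgroups_gt [OF assms(1), of xs "nat r"] by (auto simp: N_real_def)

lemma N_real_zeros:
  assumes "Factorial_Ring.prime p" "sum_list xs = 0"
  shows "N_real p xs r = (if r = 0 then 1 else 0)"
proof (cases "r = 0")
  case False
  then have "r < 0 \<or> r > int (sum_list xs)" unfolding assms(2) by linarith
  with False show ?thesis using N_real_outside [OF assms(1), of r xs] by simp
qed (simp add: N_real_def num_subgroups_0)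

lemma N_real_step:
  assumes "Factorial_Ring.prime p" "a \<ge> 1" "\<forall>x\<in>set xs. x \<le> a"
  shows "N_real p (a # xs) r = N_real p ((a - 1) # xs) r
    + real p powi (int a + int (sum_list xs) - r) * N_real p xs (r - int a)"
proof (cases "0 \<le> r \<and> r \<le> int (a + sum_list xs)")
  case True
  then obtain k where k: "r = int k" by (metis nonneg_int_cases)
  show ?thesis
  proof (cases "k < a")
    case True
    then show ?thesis using num_subgroups_step [OF assms, of k] k by (simp add: N_real_def)
  next
    case False
    have "num_subgroups p (a # xs) k = num_subgroups p ((a - 1) # xs) k +
       p ^ (a + sum_list xs - k) * num_subgroups p xs (k - a)"
      using num_subgroups_step [OF assms, of k] True False k by simp
    moreover have "int a + int (sum_list xs) - r = int (a + sum_list xs - k)" "r - int a = int (k - a)"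
      using True False k by auto
    ultimately show ?thesis using k by (simp add: N_real_def del: of_nat_diff)
  qed
next
  case False
  then show ?thesis using assms(2) by (auto simp: N_real_outside [OF assms(1)])
qed

text \<open>
  Dual to the previous recursion. Instead of using the duality of finite abelian groups, one derives it
  formally from that recursion, since the number of subgroups does not depend on the order of the parts.
\<close>

lemma N_real_step_dual:
  assumes p: "Factorial_Ring.prime p" and "a \<ge> 1" "\<forall>x\<in>set xs. x \<le> a"
  shows "N_real p (a # xs) r = N_real p ((a - 1) # xs) (r - 1) + real p powi r * N_real p xs r"
  using assms(2,3)
\<comment> \<open>Induction on the total size covers both lowering a part and removing one.\<close>
proof (induction "a + sum_list xs" arbitrary: a xs r rule: less_induct)
  case less
  let ?P = "real p"
  have P: "?P \<noteq> 0" using p by auto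
  show ?case
  proof (cases "a \<in> set xs")
    case True
    \<comment> \<open>A repeated \<open>a\<close> must be moved in front of a - 1 before anything
      applies. Facts 1, 3, 4 are the first recursion, facts 2 and 5 the dual one for smaller totals,
      and \<open>pw\<close> matches the mixed terms.\<close>
    define ys where "ys = remove1 a xs"
    have xs: "mset xs = mset (a # ys)" using True by (simp add: ys_def)
    have le: "\<forall>x\<in>set ys. x \<le> a" using less.prems by (simp add: ys_def notin_set_remove1 subset_iff) (meson notin_set_remove1)
    have sum: "sum_list xs = a + sum_list ys"
      using xs by (metis sum_mset_sum_list sum_list.Cons)
    define s where "s = int (sum_list ys)"
    have 1: "N_real p (a # a # ys) r = N_real p ((a - 1) # a # ys) r + ?P powi (2 * int a + s - r) * N_real p (a # ys) (r - int a)"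
      using N_real_step [OF p less.prems(1), of "a # ys" r] le by (simp add: s_def algebra_simps)
    have 2: "N_real p (a # (a - 1) # ys) r = N_real p ((a - 1) # (a - 1) # ys) (r - 1) + ?P powi r * N_real p ((a - 1) # ys) r"
      using less.hyps [of a "(a - 1) # ys" r] less.prems le sum by simp
    have 3: "N_real p (a # (a - 1) # ys) (r - 1) = N_real p ((a - 1) # (a - 1) # ys) (r - 1)
        + ?P powi (2 * int a + s - r) * N_real p ((a - 1) # ys) (r - 1 - int a)"
      using N_real_step [OF p less.prems(1), of "(a - 1) # ys" "r - 1"] less.prems le
      by (simp add: s_def of_nat_diff algebra_simps)
    have 4: "N_real p (a # ys) r = N_real p ((a - 1) # ys) r + ?P powi (int a + s - r) * N_real p ys (r - int a)"
      using N_real_step [OF p less.prems(1) le, of r] by (simp add: s_def)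
    have 5: "N_real p (a # ys) (r - int a) = N_real p ((a - 1) # ys) (r - 1 - int a) + ?P powi (r - int a) * N_real p ys (r - int a)"
      using less.hyps [of a ys "r - int a"] less.prems le sum by (simp add: algebra_simps)
    have pw: "?P powi (2 * int a + s - r) * ?P powi (r - int a) = ?P powi r * ?P powi (int a + s - r)"
      using P by (simp flip: power_int_add)
    have swap: "N_real p ((a - 1) # xs) t = N_real p (a # (a - 1) # ys) t" "N_real p ((a - 1) # a # ys) t = N_real p (a # (a - 1) # ys) t" for t
      using xs by (auto intro!: N_real_mset)
    have "N_real p (a # xs) r = N_real p (a # a # ys) r" "N_real p xs r = N_real p (a # ys) r"
      using xs by (auto intro!: N_real_mset)
    then show ?thesis
      using 1 2 3 4 5 pw unfolding swap by algebra
  next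
    case False
    then have le: "\<forall>x\<in>set xs. x \<le> a - 1" using less.prems
      by (metis Suc_diff_1 le_neq_implies_less less_Suc_eq_le less_eq_Suc_le One_nat_def)
    show ?thesis
    proof (cases "a = 1")
      case True
      \<comment> \<open>For \<open>a = 1\<close> the lowered part is 0 and the first recursion
        cannot be applied again; but all groups involved except the one headed by 1 are
        trivial.\<close>
      then have s0: "sum_list xs = 0" using le by simp
      then have z: "N_real p (0 # xs) t = (if t = 0 then 1 else 0)" "N_real p xs t = (if t = 0 then 1 else 0)" for t
        using N_real_zeros [OF p] by auto
      show ?thesis
        using N_real_step [OF p less.prems, of r] True s0 by (auto simp: z)
    next
      case False
      \<comment> \<open>Passing from (a, r) to (a - 1, r - 1) leaves the correction term of the
        first recursion unchanged, so the dual recursion for a - 1 carries over to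
        \<open>a\<close>.\<close>
      define s where "s = int (sum_list xs)"
      have 1: "N_real p (a # xs) r = N_real p ((a - 1) # xs) r + ?P powi (int a + s - r) * N_real p xs (r - int a)"
        using N_real_step [OF p less.prems, of r] by (simp add: s_def)
      have 2: "N_real p ((a - 1) # xs) (r - 1) = N_real p ((a - 1 - 1) # xs) (r - 1) + ?P powi (int a + s - r) * N_real p xs (r - int a)"
        using N_real_step [OF p _ le, of "r - 1"] less.prems(1) False by (simp add: s_def of_nat_diff algebra_simps)
      have 3: "N_real p ((a - 1) # xs) r = N_real p ((a - 1 - 1) # xs) (r - 1) + ?P powi r * N_real p xs r"
        using less.hyps [of "a - 1" xs r] less.prems le False by simp
      show ?thesis using 1 2 3 by simp
    qed
  qed
qed

text \<open>The dual recursion at \<open>r\<close> and the first one at r - 1 share the term for the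
  list headed by a - 1, which cancels.\<close>

lemma N_real_diff:
  assumes "Factorial_Ring.prime p" "a \<ge> 1" "\<forall>x\<in>set xs. x \<le> a"
  shows "N_real p (a # xs) r - N_real p (a # xs) (r - 1) =
    real p powi r * N_real p xs r - real p powi (int a + int (sum_list xs) + 1 - r) * N_real p xs (r - 1 - int a)"
  using N_real_step_dual [OF assms, of r] N_real_step [OF assms, of "r - 1"] by (simp add: algebra_simps)

text \<open>By the symmetry for the tail, the right-hand side of \<open>N_real_diff\<close> changes
  sign under r \<mapsto> T + 1 - r. Hence N(r) - N(T - r) has period 1 in \<open>r\<close>, and it
  vanishes for negative \<open>r\<close>.\<close>

lemma N_real_sym:
  assumes p: "Factorial_Ring.prime p" and "pos_partition lam"
  shows "N_real p lam (int (sum_list lam) - r) = N_real p lam r"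
  using assms(2)
proof (induction lam arbitrary: r)
  case Nil
  then show ?case by (simp add: N_real_zeros [OF p])
next
  case (Cons a xs)
  define T where "T = int (sum_list (a # xs))"
  define f where "f r = N_real p (a # xs) r - N_real p (a # xs) (T - r)" for r
  have pa: "a \<ge> 1" "\<forall>x\<in>set xs. x \<le> a" "pos_partition xs" using Cons.prems by (auto simp: pos_partition_Cons)
  have step: "f r = f (r - 1)" for r
  proof -
    have e: "int a + int (sum_list xs) + 1 - (T + 1 - r) = r" "T + 1 - r = int a + int (sum_list xs) + 1 - r"
      "T + 1 - r = int (sum_list xs) - (r - 1 - int a)"
      by (auto simp: T_def)
    have "N_real p xs (T + 1 - r) = N_real p xs (r - 1 - int a)"
      unfolding e(3) by (rule Cons.IH [OF pa(3)])
    moreover have "N_real p xs (T + 1 - r - 1 - int a) = N_real p xs r"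
      using Cons.IH [OF pa(3), of r] by (simp add: T_def algebra_simps)
    moreover have "N_real p (a # xs) (T + 1 - r) - N_real p (a # xs) (T - r) =
      real p powi (T + 1 - r) * N_real p xs (T + 1 - r) - real p powi r * N_real p xs (T + 1 - r - 1 - int a)"
      using N_real_diff [OF p pa(1,2), of "T + 1 - r"] unfolding e(1) by simp
    moreover have "N_real p (a # xs) r - N_real p (a # xs) (r - 1) =
      real p powi r * N_real p xs r - real p powi (T + 1 - r) * N_real p xs (r - 1 - int a)"
      using N_real_diff [OF p pa(1,2), of r] unfolding e(2) .
    ultimately have "f r - f (r - 1) = 0"
      unfolding f_def by (simp add: algebra_simps)
    then show ?thesis by simp
  qed
  have neg: "f r = 0" if "r < 0" for r
    using that N_real_outside [OF p] by (simp add: f_def T_def)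
  have "f (int n - 1) = 0" for n
  proof (induction n)
    case (Suc n) with step [of "int n"] show ?case by simp
  qed (simp add: neg)
  then have "f r = 0" for r
    using neg [of r] by (metis add_diff_cancel_right' nonneg_int_cases of_nat_Suc not_le add.commute)
  then show ?case by (simp add: f_def T_def)
qed

text \<open>\<open>N_real_diff\<close> telescopes. Its second term is nonzero only from r = a + 1
  on, hence the bound k - a.\<close>

lemma N_real_sum:
  assumes p: "Factorial_Ring.prime p" and "a \<ge> 1" "\<forall>x\<in>set xs. x \<le> a"
  shows "N_real p (a # xs) (int k) = (\<Sum>i\<le>k. real p ^ i * N_real p xs (int i))
    - (\<Sum>i<k - a. real p ^ (sum_list xs - i) * N_real p xs (int i))"
proof (induction k)
  case 0
  show ?case by (simp add: N_real_def num_subgroups_0)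
next
  case (Suc k)
  have "(\<Sum>i<Suc k - a. real p ^ (sum_list xs - i) * N_real p xs (int i)) =
     (\<Sum>i<k - a. real p ^ (sum_list xs - i) * N_real p xs (int i))
     + real p powi (int a + int (sum_list xs) + 1 - int (Suc k)) * N_real p xs (int (Suc k) - 1 - int a)"
  proof (cases "k < a")
    case True
    then show ?thesis by (simp add: N_real_def)
  next
    case False
    then have e: "Suc k - a = Suc (k - a)" "int (Suc k) - 1 - int a = int (k - a)" by auto
    show ?thesis
    proof (cases "k - a \<le> sum_list xs")
      case True
      then have "int a + int (sum_list xs) + 1 - int (Suc k) = int (sum_list xs - (k - a))" using False by auto
      then show ?thesis unfolding e by (simp del: of_nat_diff)
    next
      \<comment> \<open>Here the exponent \<open>sum_list xs - i\<close> would be truncated, but the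
        count multiplied by it is 0.\<close>
      case False
      then show ?thesis unfolding e by (simp add: N_real_outside [OF p] del: of_nat_diff)
    qed
  qed
  moreover have "N_real p (a # xs) (int (Suc k)) - N_real p (a # xs) (int k) = real p ^ Suc k * N_real p xs (int (Suc k))
     - real p powi (int a + int (sum_list xs) + 1 - int (Suc k)) * N_real p xs (int (Suc k) - 1 - int a)"
    using N_real_diff [OF assms, of "int (Suc k)"] power_int_of_nat [of "real p" "Suc k"] by simp
  ultimately show ?case
    using Suc.IH by (simp only: sum.atMost_Suc)
qed

section \<open>The counting polynomials\<close>

fun subgroup_poly :: "nat list \<Rightarrow> nat \<Rightarrow> int poly" where
  "subgroup_poly [] k = (if k = 0 then 1 else 0)"
| "subgroup_poly (a # xs) k = (\<Sum>i\<le>k. monom 1 i * subgroup_poly xs i) - (\<Sum>i<k - a. monom 1 (sum_list xs - i) * subgroup_poly xs i)"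

text \<open>The recursion of \<open>subgroup_poly\<close> is \<open>N_real_sum\<close> with the
  variable in place of p.\<close>

lemma poly_subgroup_poly:
  assumes p: "Factorial_Ring.prime p" and "pos_partition lam"
  shows "poly (subgroup_poly lam k) (int p) = int (num_subgroups p lam k)"
  using assms(2)
proof (induction lam arbitrary: k)
  case Nil
  have "N_real p [] (int k) = (if k = 0 then 1 else 0)" by (simp add: N_real_zeros [OF p])
  then show ?case by (auto simp: N_real_def split: if_splits)
next
  case (Cons a xs)
  then have pa: "a \<ge> 1" "\<forall>x\<in>set xs. x \<le> a" "pos_partition xs" by (auto simp: pos_partition_Cons)
  have IH: "real_of_int (poly (subgroup_poly xs i) (int p)) = N_real p xs (int i)" for i
    using Cons.IH [OF pa(3)] by (simp add: N_real_def)
  have "real_of_int (poly (subgroup_poly (a # xs) k) (int p)) = N_real p (a # xs) (int k)"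
    unfolding N_real_sum [OF p pa(1,2)] by (simp add: poly_sum poly_monom IH)
  then show ?case by (simp add: N_real_def)
qed

text \<open>The difference has infinitely many roots. This gives the uniqueness behind
  \<open>N_poly\<close> and carries identities of counts over to polynomials.\<close>

lemma poly_eq_primes:
  fixes P R :: "int poly"
  assumes "\<And>p::nat. Factorial_Ring.prime p \<Longrightarrow> poly P (int p) = poly R (int p)"
  shows "P = R"
proof (rule ccontr)
  assume "P \<noteq> R"
  then have "finite {x. poly (P - R) x = 0}" by (intro poly_roots_finite) simp
  moreover have "int ` {p::nat. Factorial_Ring.prime p} \<subseteq> {x. poly (P - R) x = 0}"
    using assms by auto
  ultimately have "finite {p::nat. Factorial_Ring.prime p}"
    by (meson finite_imageD finite_subset inj_on_of_nat)
  with primes_infinite show False by simp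
qed

lemma N_poly_eq:
  assumes "pos_partition lam" shows "N_poly lam k = subgroup_poly lam k"
  unfolding N_poly_def
proof (rule the_equality)
  show "\<forall>p::nat. Factorial_Ring.prime p \<longrightarrow> poly (subgroup_poly lam k) (int p) = int (num_subgroups p lam k)"
    using poly_subgroup_poly assms by blast
  fix P assume "\<forall>p::nat. Factorial_Ring.prime p \<longrightarrow> poly P (int p) = int (num_subgroups p lam k)"
  then show "P = subgroup_poly lam k" using poly_subgroup_poly assms by (intro poly_eq_primes) auto
qed

lemma subgroup_poly_gt: "pos_partition lam \<Longrightarrow> k > sum_list lam \<Longrightarrow> subgroup_poly lam k = 0"
  by (rule poly_eq_primes) (simp add: poly_subgroup_poly num_subgroups_gt)

lemma subgroup_poly_sym:
  assumes "pos_partition lam" "k \<le> sum_list lam"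
  shows "subgroup_poly lam (sum_list lam - k) = subgroup_poly lam k"
proof (rule poly_eq_primes)
  fix p :: nat assume p: "Factorial_Ring.prime p"
  have "N_real p lam (int (sum_list lam - k)) = N_real p lam (int k)"
    using N_real_sym [OF p assms(1), of "int k"] assms(2) by (simp add: of_nat_diff)
  then show "poly (subgroup_poly lam (sum_list lam - k)) (int p) = poly (subgroup_poly lam k) (int p)"
    by (simp add: poly_subgroup_poly [OF p assms(1)] N_real_def)
qed

declare subgroup_poly.simps [simp del]

section \<open>The coefficients\<close>

lemma pos_partition_drop: "pos_partition lam \<Longrightarrow> pos_partition (drop l lam)"
  unfolding pos_partition_def by (metis in_set_dropD sorted_wrt_drop)

text \<open>The list form of \<open>c_sum lam 0\<close>; by \<open>c_sum_eq\<close>, dropping l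
  entries first gives c_l. In particular od and ev are its values at the list and at its
  tail.\<close>

fun odd_index_sum :: "nat list \<Rightarrow> nat" where
  "odd_index_sum [] = 0"
| "odd_index_sum [x] = x"
| "odd_index_sum (x # y # zs) = x + odd_index_sum zs"

text \<open>The list form of \<open>a_sum lam 0\<close>: prepending a part turns the weight [i/2]
  into [(i+1)/2], which is larger by 1 exactly for odd i.\<close>

fun half_weighted_sum :: "nat list \<Rightarrow> nat" where
  "half_weighted_sum [] = 0"
| "half_weighted_sum (x # xs) = half_weighted_sum xs + odd_index_sum xs"

lemma odd_index_sum_Cons: "odd_index_sum (x # xs) = x + odd_index_sum (tl xs)"
  by (cases xs) auto

lemma odd_index_sum_add_odd_index_sum_tl: "odd_index_sum lam + odd_index_sum (tl lam) = sum_list lam"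
  by (induction lam) (auto simp: odd_index_sum_Cons)

text \<open>This is ev \<le> od, obtained by comparing the entries in pairs; it makes all intervals
  J_l nonempty.\<close>

lemma odd_index_sum_tl_le: "pos_partition lam \<Longrightarrow> odd_index_sum (tl lam) \<le> odd_index_sum lam"
proof (induction lam rule: odd_index_sum.induct)
  case (3 x y zs)
  then show ?case by (auto simp: pos_partition_Cons odd_index_sum_Cons intro!: add_mono)
qed auto

lemma odd_index_sum_le: "odd_index_sum lam \<le> sum_list lam"
  using odd_index_sum_add_odd_index_sum_tl [of lam] by simp

lemma c_sum_Suc: "c_sum (x # xs) (Suc l) = c_sum xs l"
  unfolding c_sum_def
  by (rule sum.reindex_bij_witness [where i = Suc and j = "\<lambda>i. i - 1"])
     (auto simp: part_def nth_Cons' Suc_le_eq)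

lemma c_sum_0: "c_sum xs 0 = odd_index_sum xs"
proof (induction xs)
  case Nil
  show ?case by (simp add: c_sum_def)
next
  case (Cons x xs)
  have "c_sum (x # xs) 0 + c_sum (x # xs) 1 = x + sum_list xs"
    using c_sum_0_plus_1 [of "x # xs"] by simp
  moreover have "c_sum (x # xs) 1 = odd_index_sum xs"
    using Cons.IH by (simp add: c_sum_Suc)
  ultimately show ?case using odd_index_sum_add_odd_index_sum_tl [of "x # xs"] by simp
qed

lemma c_sum_eq: "c_sum lam l = odd_index_sum (drop l lam)"
proof (induction lam arbitrary: l)
  case Nil
  show ?case by (simp add: c_sum_def)
next
  case (Cons x xs)
  then show ?case by (cases l) (simp_all add: c_sum_0 c_sum_Suc)
qed

lemma a_sum_Suc: "a_sum (x # xs) (Suc l) = a_sum xs l"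
  unfolding a_sum_def
  by (rule sum.reindex_bij_witness [where i = Suc and j = "\<lambda>i. i - 1"])
     (auto simp: part_def nth_Cons' Suc_le_eq)

lemma a_sum_0: "a_sum xs 0 = half_weighted_sum xs"
proof (induction xs)
  case Nil
  show ?case by (simp add: a_sum_def)
next
  case (Cons x xs)
  let ?n = "length xs"
  have "a_sum (x # xs) 0 = (\<Sum>i = 1..?n. ((i + 1) div 2) * part xs i)"
    unfolding a_sum_def
    by (rule sum.reindex_bij_witness [where i = Suc and j = "\<lambda>i. i - 1"])
       (auto simp: part_def nth_Cons' Suc_le_eq)
  also have "\<dots> = (\<Sum>i = 1..?n. (i div 2) * part xs i + (if \<exists>j. i = 0 + 1 + 2 * j then part xs i else 0))"
  proof (rule sum.cong)
    fix i :: nat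
    have "(i + 1) div 2 = i div 2 + (if odd i then 1 else 0)" by auto
    moreover have "odd i \<longleftrightarrow> (\<exists>j. i = 0 + 1 + 2 * j)" by (auto elim!: oddE)
    ultimately show "((i + 1) div 2) * part xs i = (i div 2) * part xs i + (if \<exists>j. i = 0 + 1 + 2 * j then part xs i else 0)"
      by (simp add: add_mult_distrib)
  qed simp
  also have "\<dots> = (\<Sum>i = 1..?n. (i div 2) * part xs i) + c_sum xs 0"
    unfolding sum.distrib c_sum_def by (subst sum.inter_filter) auto
  \<comment> \<open>The index 1, which \<open>a_sum\<close> omits, has weight 0.\<close>
  also have "(\<Sum>i = 1..?n. (i div 2) * part xs i) = a_sum xs 0"
    unfolding a_sum_def by (rule sum.mono_neutral_cong_right) (auto simp: not_le less_Suc_eq)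
  finally show ?case using Cons.IH by (simp add: c_sum_0)
qed

lemma a_sum_eq: "a_sum lam l = half_weighted_sum (drop l lam)"
proof (induction lam arbitrary: l)
  case Nil
  show ?case by (simp add: a_sum_def)
next
  case (Cons x xs)
  then show ?case by (cases l) (simp_all add: a_sum_0 a_sum_Suc)
qed

lemma ev_sum_eq: "ev_sum lam = odd_index_sum (tl lam)"
  by (simp add: ev_sum_def c_sum_eq drop_Suc)

lemma od_sum_eq: "od_sum lam = odd_index_sum lam"
  by (simp add: od_sum_def c_sum_eq)

lemma J_set_eq: "J_set lam l = {odd_index_sum (drop (Suc l) lam)..odd_index_sum (drop l lam)}"
  by (simp add: J_set_def c_sum_eq)

lemma J_set_Cons: "J_set (x # xs) (Suc l) = J_set xs l"
  by (simp add: J_set_eq)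

lemma J_set_0: "J_set lam 0 = {odd_index_sum (tl lam)..odd_index_sum lam}"
  by (simp add: J_set_eq drop_Suc)

section \<open>Recursion for C along tails\<close>

lemma C_short: "length lam \<le> 2 \<Longrightarrow> C_coeff lam k = 1"
  by (simp add: C_coeff.simps)

text \<open>Length 2 is the only case not contained in the definition: there the range of summation
  shrinks to the single index \<open>y\<close>, so the sum is 1 as well.\<close>

lemma C_sum:
  assumes "pos_partition (x # y # nu)" "k \<in> J_set (x # y # nu) 0"
  shows "C_coeff (x # y # nu) k =
    (\<Sum>i = max (odd_index_sum (y # nu)) (k + y - x)..min k (odd_index_sum (x # y # nu) + y - x). C_coeff (y # nu) i)"
proof (cases nu)
  case Nil
  then have "y \<le> k" "k \<le> x" using assms(2) by (auto simp: J_set_0)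
  then have "max (odd_index_sum (y # nu)) (k + y - x) = y" "min k (odd_index_sum (x # y # nu) + y - x) = y"
    using Nil by auto
  then show ?thesis using Nil by (simp add: C_short)
next
  case (Cons z zs)
  then show ?thesis
    using assms(2) C_coeff.simps [of "x # y # nu" k]
    by (simp add: ev_sum_eq od_sum_eq part_def)
qed

text \<open>Below ev the first part only shifts the index of the interval that contains
  \<open>k\<close>. At the common end point k = ev the defining sum has the single index
  \<open>k\<close>, so both branches agree.\<close>

lemma C_cut:
  assumes "pos_partition (x # mu)" "k \<le> odd_index_sum mu"
  shows "C_coeff (x # mu) k = C_coeff mu k"
proof (cases "length mu \<le> 1")
  case True
  then show ?thesis by (simp add: C_short)
next
  case False
  then obtain y nu where mu: "mu = y # nu" "nu \<noteq> []" by (cases mu) auto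
  show ?thesis
  proof (cases "k = odd_index_sum mu")
    case True
    have "y \<le> x" using assms mu by (simp add: pos_partition_Cons)
    then have k: "k \<in> J_set (x # y # nu) 0" "k + y - x \<le> k" "k \<le> y + odd_index_sum nu"
      using True odd_index_sum_tl_le [OF assms(1)] mu odd_index_sum_tl_le [of nu] assms(1)
      by (auto simp: J_set_0 odd_index_sum_Cons pos_partition_Cons)
    then have "max (odd_index_sum (y # nu)) (k + y - x) = k" "min k (odd_index_sum (x # y # nu) + y - x) = k"
      using True mu by auto
    then show ?thesis using C_sum [OF _ k(1)] assms mu by simp
  next
    case False
    with assms have lt: "k < odd_index_sum mu" by simp
    let ?lam = "x # mu"
    let ?P = "\<lambda>l. 1 \<le> l \<and> k \<in> J_set ?lam l"
    obtain l0 where l0: "?P l0"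
      using ex_index_below_ev [of k ?lam] lt by (auto simp: ev_sum_eq)
    have C: "C_coeff ?lam k = C_coeff (drop (LEAST l. ?P l) ?lam) k"
      using lt mu C_coeff.simps [of ?lam k] by (cases nu) (auto simp: J_set_0 ev_sum_eq)
    \<comment> \<open>The search for the interval starts at 1 for \<open>?lam\<close>, hence at 0
      for \<open>mu\<close>.\<close>
    have L: "(LEAST l. ?P l) = Suc (LEAST l. k \<in> J_set mu l)"
      using Least_Suc [of ?P, OF l0] by (simp add: J_set_Cons)
    show ?thesis
    proof (cases "k \<in> J_set mu 0")
      case True
      then have "(LEAST l. k \<in> J_set mu l) = 0" by (simp add: Least_eq_0)
      then show ?thesis using C L by simp
    next
      case False
      then have lt': "k < odd_index_sum (tl mu)" using lt by (auto simp: J_set_0)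
      have same: "(LEAST l. k \<in> J_set mu l) = (LEAST l. 1 \<le> l \<and> k \<in> J_set mu l)"
        using False by (metis less_one linorder_not_less)
      show ?thesis
      proof (cases "length mu \<le> 2")
        case True
        then show ?thesis using C L by (simp add: C_short)
      next
        case len: False
        then have "C_coeff mu k = C_coeff (drop (LEAST l. k \<in> J_set mu l) mu) k"
          using lt' False C_coeff.simps [of mu k] by (simp add: ev_sum_eq same)
        then show ?thesis using C L by simp
      qed
    qed
  qed
qed

text \<open>Iterates \<open>C_cut\<close>. It holds for any interval containing \<open>k\<close>,
  not just the least one, so shared end points cause no ambiguity.\<close>

lemma C_drop:
  assumes "pos_partition lam" "k \<le> odd_index_sum (drop l lam)"
  shows "C_coeff lam k = C_coeff (drop l lam) k"
  using assms
proof (induction lam arbitrary: l)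
  case (Cons x mu)
  show ?case
  proof (cases l)
    case (Suc m)
    have "odd_index_sum (drop m mu) \<le> odd_index_sum mu" for m
    proof (induction m)
      case (Suc m)
      have "pos_partition (drop m mu)" using Cons.prems pos_partition_drop by (auto simp: pos_partition_Cons)
      from odd_index_sum_tl_le [OF this] Suc show ?case by (simp add: drop_Suc tl_drop)
    qed simp
    then have "k \<le> odd_index_sum mu" using Cons.prems Suc order_trans by auto
    then show ?thesis
      using Cons.IH [of m] Cons.prems Suc C_cut [OF Cons.prems(1)] by (simp add: pos_partition_Cons)
  qed simp
qed simp

text \<open>For k in J_0 of \<open>x # y # nu\<close> this is the summation range of the recursion
  shifted down by \<open>y\<close>: the interval from k - x to k - y, sliding with \<open>k\<close>,
  cut to J_0 of \<open>nu\<close>.\<close>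

definition window :: "nat \<Rightarrow> nat \<Rightarrow> nat list \<Rightarrow> nat \<Rightarrow> nat set" where
  "window x y nu k = {j \<in> J_set nu 0. j + y \<le> k \<and> k \<le> j + x}"

text \<open>
  The two claims are proved together: applied to the tails, the symmetries show that on the summation range
  \<open>C(n-1,\<lambda>';i) = C(n-2,\<lambda>'';i-\<lambda>\<^sub>2)\<close> where \<open>\<lambda>'' = (\<lambda>\<^sub>3, \<dots>, \<lambda>\<^sub>n)\<close>, which makes the recursion
  visibly symmetric.
\<close>

lemma C_window_sym:
  "pos_partition lam \<Longrightarrow>
     (\<forall>k \<le> sum_list lam. C_coeff lam (sum_list lam - k) = C_coeff lam k) \<and>
     (\<forall>x y nu k. lam = x # y # nu \<longrightarrow> k \<in> J_set lam 0 \<longrightarrow>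
        C_coeff lam k = (\<Sum>j\<in>window x y nu k. C_coeff nu j))"
proof (induction "length lam" arbitrary: lam rule: less_induct)
  case less
  show ?case
  proof (cases "length lam \<le> 1")
    case True
    then show ?thesis by (auto simp: C_short)
  next
    case False
    then obtain x y nu where lam: "lam = x # y # nu" by (cases lam rule: odd_index_sum.cases) auto
    have pt: "pos_partition (y # nu)" "pos_partition nu" "y \<le> x" using less.prems lam by (auto simp: pos_partition_Cons)
    have sym_mu: "C_coeff (y # nu) (y + sum_list nu - k) = C_coeff (y # nu) k" if "k \<le> y + sum_list nu" for k
      using less.hyps [of "y # nu"] pt lam that by simp
    have sym_nu: "C_coeff nu (sum_list nu - k) = C_coeff nu k" if "k \<le> sum_list nu" for k
      using less.hyps [of nu] pt lam that by simp
    have o: "odd_index_sum nu + odd_index_sum (tl nu) = sum_list nu" "odd_index_sum (tl nu) \<le> odd_index_sum nu"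
      using odd_index_sum_add_odd_index_sum_tl odd_index_sum_tl_le pt by auto
    \<comment> \<open>The symmetry for \<open>y # nu\<close> takes j + y to |nu| - j, where
      \<open>y\<close> can be cut off; the symmetry for \<open>nu\<close> then takes |nu| - j back
      to j.\<close>
    have plateau: "C_coeff (y # nu) (j + y) = C_coeff nu j" if j: "j \<in> J_set nu 0" for j
    proof -
      have j': "odd_index_sum (tl nu) \<le> j" "j \<le> odd_index_sum nu" using j by (auto simp: J_set_0)
      have "C_coeff (y # nu) (j + y) = C_coeff (y # nu) (sum_list nu - j)"
        using sym_mu [of "j + y"] j' o by simp
      also have "\<dots> = C_coeff nu (sum_list nu - j)"
        using j' o by (intro C_cut [OF pt(1)]) simp
      also have "\<dots> = C_coeff nu j" using j' o by (intro sym_nu) simp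
      finally show ?thesis .
    qed
    have W: "C_coeff lam k = (\<Sum>j\<in>window x y nu k. C_coeff nu j)" if k: "k \<in> J_set lam 0" for k
    proof -
      have "C_coeff lam k = (\<Sum>i = max (odd_index_sum (y # nu)) (k + y - x)..min k (odd_index_sum (x # y # nu) + y - x). C_coeff (y # nu) i)"
        using C_sum less.prems k lam by simp
      also have "\<dots> = (\<Sum>j\<in>window x y nu k. C_coeff nu j)"
      proof (rule sum.reindex_bij_witness [where i = "\<lambda>j. j + y" and j = "\<lambda>i. i - y"])
        fix i assume "i \<in> {max (odd_index_sum (y # nu)) (k + y - x)..min k (odd_index_sum (x # y # nu) + y - x)}"
        then have i: "y \<le> i" "i - y \<in> window x y nu k"
          by (auto simp: window_def J_set_0 odd_index_sum_Cons)
        then show "i - y + y = i" "i - y \<in> window x y nu k" by auto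
        show "C_coeff nu (i - y) = C_coeff (y # nu) i"
          using plateau [of "i - y"] i by (simp add: window_def)
      qed (use pt(3) in \<open>auto simp: window_def J_set_0 odd_index_sum_Cons\<close>)
      finally show ?thesis .
    qed
    have "C_coeff lam (sum_list lam - k) = C_coeff lam k" if kle: "k \<le> sum_list lam" for k
    proof (cases "length lam \<le> 2")
      case True
      then show ?thesis by (simp add: C_short)
    next
      case len: False
      have T: "odd_index_sum lam + odd_index_sum (tl lam) = sum_list lam" "odd_index_sum (tl lam) \<le> odd_index_sum lam"
        using odd_index_sum_add_odd_index_sum_tl odd_index_sum_tl_le less.prems by auto
      consider "k < odd_index_sum (tl lam)" | "k \<in> J_set lam 0" | "k > odd_index_sum lam"
        by (force simp: J_set_0)
      then show ?thesis
      proof cases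
        case 1
        then have "\<not> sum_list lam - k \<in> J_set lam 0" "\<not> sum_list lam - k < ev_sum lam"
          using T by (auto simp: J_set_0 ev_sum_eq)
        then have "C_coeff lam (sum_list lam - k) = C_coeff lam (sum_list lam - (sum_list lam - k))"
          using C_coeff.simps [of lam "sum_list lam - k"] len by simp
        then show ?thesis using kle by simp
      next
        case 2
        then have k': "sum_list lam - k \<in> J_set lam 0" using T by (auto simp: J_set_0)
        show ?thesis
          unfolding W [OF 2] W [OF k']
        \<comment> \<open>As |lam| = x + y + |nu|, the reflection j \<mapsto> |nu| - j exchanges the
          windows of k and |lam| - k.\<close>
        proof (rule sum.reindex_bij_witness [where i = "\<lambda>j. sum_list nu - j" and j = "\<lambda>j. sum_list nu - j"])
          fix j assume "j \<in> window x y nu k"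
          then show "sum_list nu - j \<in> window x y nu (sum_list lam - k)"
            using o kle lam by (auto simp: window_def J_set_0)
        next
          fix j assume "j \<in> window x y nu (sum_list lam - k)"
          then show "sum_list nu - j \<in> window x y nu k" "C_coeff nu (sum_list nu - j) = C_coeff nu j"
            using o kle lam sym_nu by (auto simp: window_def J_set_0)
        qed (use o in \<open>auto simp: window_def J_set_0\<close>)
      next
        case 3
        then have "\<not> k \<in> J_set lam 0" "\<not> k < ev_sum lam"
          using T by (auto simp: J_set_0 ev_sum_eq)
        then show ?thesis using C_coeff.simps [of lam k] len by simp
      qed
    qed
    with W lam show ?thesis by auto
  qed
qed

section \<open>Positivity, end values and unimodality of C\<close>

lemma C_sym: "pos_partition lam \<Longrightarrow> k \<le> sum_list lam \<Longrightarrow> C_coeff lam (sum_list lam - k) = C_coeff lam k"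
  using C_window_sym by blast

lemma C_window:
  "pos_partition (x # y # nu) \<Longrightarrow> k \<in> J_set (x # y # nu) 0 \<Longrightarrow>
    C_coeff (x # y # nu) k = (\<Sum>j\<in>window x y nu k. C_coeff nu j)"
  using C_window_sym by blast

lemma finite_window [simp]: "finite (window x y nu k)"
  by (simp add: window_def J_set_def)

text \<open>Ensures that the coefficient found at the degree bound does not vanish. On J_0 the
  window is nonempty and its summands are positive by induction.\<close>

lemma C_pos: "pos_partition lam \<Longrightarrow> k \<le> sum_list lam \<Longrightarrow> C_coeff lam k > 0"
proof (induction "length lam" arbitrary: lam k rule: less_induct)
  case less
  have T: "odd_index_sum lam + odd_index_sum (tl lam) = sum_list lam" "odd_index_sum (tl lam) \<le> odd_index_sum lam"
    using odd_index_sum_add_odd_index_sum_tl odd_index_sum_tl_le less.prems by auto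
  have *: "C_coeff lam k > 0" if k: "k \<le> odd_index_sum lam" for k
  proof (cases "length lam \<le> 1")
    case True
    then show ?thesis by (auto simp: C_short)
  next
    case False
    then obtain x y nu where lam: "lam = x # y # nu" by (cases lam rule: odd_index_sum.cases) auto
    have pt: "pos_partition (y # nu)" "pos_partition nu" "y \<le> x" using less.prems lam by (auto simp: pos_partition_Cons)
    have o: "odd_index_sum nu + odd_index_sum (tl nu) = sum_list nu" "odd_index_sum (tl nu) \<le> odd_index_sum nu"
      using odd_index_sum_add_odd_index_sum_tl odd_index_sum_tl_le pt by auto
    show ?thesis
    proof (cases "k < odd_index_sum (y # nu)")
      case True
      then have "C_coeff lam k = C_coeff (y # nu) k" using C_cut less.prems lam by simp
      moreover have "k \<le> sum_list (y # nu)" using True odd_index_sum_le [of "y # nu"] by simp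
      ultimately show ?thesis using less.hyps [of "y # nu" k] pt lam by simp
    next
      case False
      then have kJ: "k \<in> J_set lam 0" using k lam by (auto simp: J_set_0)
      \<comment> \<open>The least element of the window.\<close>
      have "max (odd_index_sum (tl nu)) (k - x) \<in> window x y nu k"
        using False k lam o pt by (auto simp: window_def J_set_0 odd_index_sum_Cons)
      moreover have "C_coeff nu j > 0" if "j \<in> window x y nu k" for j
        using that less.hyps [of nu j] pt lam odd_index_sum_le [of nu] by (auto simp: window_def J_set_0)
      ultimately have "(\<Sum>j\<in>window x y nu k. C_coeff nu j) > 0"
        by (intro sum_pos) auto
      then show ?thesis using C_window kJ less.prems lam by simp
    qed
  qed
  show ?case
  proof (cases "k \<le> odd_index_sum lam")
    case False
    then have "sum_list lam - k \<le> odd_index_sum lam" using T less.prems by simp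
    then show ?thesis using * C_sym less.prems by metis
  qed (rule *)
qed

text \<open>Reflection takes od to ev, where the first part can be cut off; there ev is the od of
  the tail.\<close>

lemma C_odd_index_sum: "pos_partition lam \<Longrightarrow> C_coeff lam (odd_index_sum lam) = 1"
proof (induction lam)
  case (Cons x xs)
  have "odd_index_sum (x # xs) + odd_index_sum xs = sum_list (x # xs)"
    using odd_index_sum_add_odd_index_sum_tl [of "x # xs"] by simp
  then have "C_coeff (x # xs) (odd_index_sum (x # xs)) = C_coeff (x # xs) (odd_index_sum xs)"
    using C_sym [OF Cons.prems, of "odd_index_sum xs"] by (metis add_diff_cancel_right' le_add2)
  then show ?case using C_cut [OF Cons.prems] Cons by (simp add: pos_partition_Cons)
qed (simp add: C_short)

text \<open>The condition i + j \<le> |lam| lets \<open>j\<close> lie beyond the centre as long as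
  it is no farther from it than \<open>i\<close>. The induction needs this form, since the two
  indices compared for \<open>nu\<close> may lie on different sides.\<close>

lemma C_unimodal:
  assumes "pos_partition lam" "odd_index_sum (tl lam) \<le> i" "i \<le> j" "i + j \<le> sum_list lam"
  shows "C_coeff lam i \<le> C_coeff lam j"
  using assms
proof (induction lam arbitrary: i j rule: odd_index_sum.induct)
  case (3 x y nu)
  let ?lam = "x # y # nu"
  have pt: "pos_partition (y # nu)" "pos_partition nu" "y \<le> x" using 3 by (auto simp: pos_partition_Cons)
  have o: "odd_index_sum nu + odd_index_sum (tl nu) = sum_list nu" "odd_index_sum (tl nu) \<le> odd_index_sum nu"
    using odd_index_sum_add_odd_index_sum_tl odd_index_sum_tl_le pt by auto
  have T: "odd_index_sum ?lam + odd_index_sum (y # nu) = sum_list ?lam" "odd_index_sum (y # nu) \<le> odd_index_sum ?lam"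
    using odd_index_sum_add_odd_index_sum_tl [of ?lam] odd_index_sum_tl_le [OF "3.prems"(1)] by auto
  have step: "C_coeff ?lam k \<le> C_coeff ?lam (Suc k)"
    if k: "odd_index_sum (y # nu) \<le> k" "2 * k + 1 \<le> sum_list ?lam" for k
  proof -
    let ?W = "window x y nu k" and ?W' = "window x y nu (Suc k)"
    have J: "k \<in> J_set ?lam 0" "Suc k \<in> J_set ?lam 0"
      using k T by (auto simp: J_set_0)
    have nn: "C_coeff nu j \<ge> 0" if "j \<in> ?W'" for j
      using that C_pos [OF pt(2), of j] odd_index_sum_le [of nu] by (auto simp: window_def J_set_0)
    have "(\<Sum>j\<in>?W. C_coeff nu j) = (\<Sum>j\<in>?W \<inter> ?W'. C_coeff nu j) + (\<Sum>j\<in>?W - ?W'. C_coeff nu j)"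
      by (metis finite_window sum.Int_Diff)
    moreover have "(\<Sum>j\<in>?W'. C_coeff nu j) = (\<Sum>j\<in>?W \<inter> ?W'. C_coeff nu j) + (\<Sum>j\<in>?W' - ?W. C_coeff nu j)"
      by (metis finite_window sum.Int_Diff inf_commute)
    moreover have "(\<Sum>j\<in>?W - ?W'. C_coeff nu j) \<le> (\<Sum>j\<in>?W' - ?W. C_coeff nu j)"
    proof (cases "?W - ?W' = {}")
      case True
      then show ?thesis using nn by (metis Diff_iff sum.empty sum_nonneg)
    next
      case False
      then obtain i where "i \<in> ?W - ?W'" by blast
      then have i: "i + x = k" "odd_index_sum (tl nu) \<le> i" "i \<le> odd_index_sum nu"
        by (auto simp: window_def J_set_0)
      \<comment> \<open>If i = k - x leaves the window, then k + 1 - y really enters it: i is at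
        least ev of \<open>nu\<close> and i + (k + 1 - y) \<le> |nu|, so k + 1 - y is at most od of
        \<open>nu\<close>.\<close>
      then have eq: "?W - ?W' = {i}" "?W' - ?W = {Suc k - y}"
        using k o pt(3) by (auto simp: window_def J_set_0)
      have "C_coeff nu i \<le> C_coeff nu (Suc k - y)"
        using i k o pt(3) by (intro "3.IH" pt(2)) auto
      then show ?thesis unfolding eq by simp
    qed
    ultimately show ?thesis
      unfolding C_window [OF "3.prems"(1) J(1)] C_window [OF "3.prems"(1) J(2)] by linarith
  qed
  have chain: "C_coeff ?lam i \<le> C_coeff ?lam (i + d)" if "2 * (i + d) \<le> sum_list ?lam" for d
    using that
  proof (induction d)
    case (Suc d)
    have "C_coeff ?lam (i + d) \<le> C_coeff ?lam (Suc (i + d))"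
      using "3.prems" Suc.prems by (intro step) auto
    with Suc show ?case by simp
  qed simp
  show ?case
  proof (cases "2 * j \<le> sum_list ?lam")
    case True
    then show ?thesis using chain [of "j - i"] "3.prems" by simp
  next
    \<comment> \<open>A \<open>j\<close> beyond the centre is replaced by its reflection, which is
      still at least \<open>i\<close>.\<close>
    case False
    then have "C_coeff ?lam i \<le> C_coeff ?lam (sum_list ?lam - j)"
      using chain [of "sum_list ?lam - j - i"] "3.prems" by simp
    then show ?thesis using C_sym [OF "3.prems"(1), of j] "3.prems" by simp
  qed
qed (simp_all add: C_short)

section \<open>Leading terms\<close>

lemma coeff_monom_mult_0: "degree P + i < m \<Longrightarrow> coeff (monom 1 i * P) m = (0::int)"
  by (simp add: coeff_monom_mult coeff_eq_0)

text \<open>That is, a_l = a_(l+1) + c_(l+1). Hence l k + a_l grows by k - c_(l+1) from l to l + 1,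
  and these increments increase with l.\<close>

lemma half_weighted_sum_drop: "half_weighted_sum (drop l lam) = half_weighted_sum (drop (Suc l) lam) + odd_index_sum (drop (Suc l) lam)"
proof (cases "l < length lam")
  case True
  then show ?thesis by (simp flip: Cons_nth_drop_Suc)
qed simp

lemma odd_index_sum_drop_antimono: "pos_partition lam \<Longrightarrow> l \<le> m \<Longrightarrow> odd_index_sum (drop m lam) \<le> odd_index_sum (drop l lam)"
proof (rule lift_Suc_antimono_le [of "\<lambda>l. odd_index_sum (drop l lam)"])
  fix n assume "pos_partition lam"
  from odd_index_sum_tl_le [OF pos_partition_drop [OF this, of n]] show "odd_index_sum (drop (Suc n) lam) \<le> odd_index_sum (drop n lam)"
    by (simp add: drop_Suc tl_drop)
qed auto

lemma ex_J_set: "k \<le> odd_index_sum lam \<Longrightarrow> \<exists>m. k \<in> J_set lam m"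
proof (induction lam)
  case Nil
  then show ?case by (auto simp: J_set_eq)
next
  case (Cons x xs)
  show ?case
  proof (cases "odd_index_sum xs \<le> k")
    case True
    with Cons.prems have "k \<in> J_set (x # xs) 0" by (simp add: J_set_0)
    then show ?thesis ..
  next
    case False
    with Cons.IH obtain m where "k \<in> J_set (x # xs) (Suc m)" by (auto simp: J_set_Cons)
    then show ?thesis ..
  qed
qed

text \<open>The exponent \<open>\<ell> k + a\<^sub>\<ell>(\<lambda>)\<close> is a convex function of \<open>\<ell>\<close>, minimal where \<open>k \<in> J\<^sub>\<ell>(\<lambda>)\<close>.\<close>

lemma exponent_min:
  assumes "pos_partition lam" "k \<in> J_set lam m"
  shows "m * k + half_weighted_sum (drop m lam) \<le> l * k + half_weighted_sum (drop l lam)"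
proof (cases "m \<le> l")
  case True
  then show ?thesis
  proof (induction l rule: dec_induct)
    case (step l)
    have "odd_index_sum (drop (Suc l) lam) \<le> odd_index_sum (drop (Suc m) lam)"
      using step by (intro odd_index_sum_drop_antimono assms) auto
    then show ?case using step assms(2) half_weighted_sum_drop [of l lam] by (simp add: J_set_eq)
  qed simp
next
  case False
  then have "l \<le> m" by simp
  then show ?thesis
  proof (induction l rule: inc_induct)
    case (step l)
    have "odd_index_sum (drop m lam) \<le> odd_index_sum (drop (Suc l) lam)"
      using step by (intro odd_index_sum_drop_antimono assms) auto
    then show ?case using step assms(2) half_weighted_sum_drop [of l lam] by (simp add: J_set_eq)
  qed simp
qed

text \<open>The degree bound is demanded for every \<open>l\<close>, not only for k in J_l: in the
  induction, bounds with other \<open>l\<close> show that the competing summands have smaller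
  degree.\<close>

definition has_lead :: "nat list \<Rightarrow> bool" where
  "has_lead lam \<longleftrightarrow>
    (\<forall>l k. degree (subgroup_poly lam k) \<le> l * k + half_weighted_sum (drop l lam)) \<and>
    (\<forall>l k. k \<in> J_set lam l \<longrightarrow> coeff (subgroup_poly lam k) (l * k + half_weighted_sum (drop l lam)) = C_coeff lam k)"

text \<open>Up to od this is convexity of the exponent; above od, reflection leaves the polynomial
  unchanged and makes \<open>k\<close> smaller.\<close>

lemma degree_subgroup_poly_extend:
  assumes pt: "pos_partition lam"
    and deg: "\<And>l k. k \<in> J_set lam l \<Longrightarrow> degree (subgroup_poly lam k) \<le> l * k + half_weighted_sum (drop l lam)"
  shows "degree (subgroup_poly lam k) \<le> l * k + half_weighted_sum (drop l lam)"
proof -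
  have T: "odd_index_sum lam + odd_index_sum (tl lam) = sum_list lam" "odd_index_sum (tl lam) \<le> odd_index_sum lam"
    using odd_index_sum_add_odd_index_sum_tl odd_index_sum_tl_le pt by auto
  have *: "degree (subgroup_poly lam k) \<le> l * k + half_weighted_sum (drop l lam)" if k: "k \<le> odd_index_sum lam" for k
  proof -
    obtain m where m: "k \<in> J_set lam m" using ex_J_set k by blast
    from deg [OF m] exponent_min [OF pt m, of l] show ?thesis by (rule order_trans)
  qed
  consider "k \<le> odd_index_sum lam" | "odd_index_sum lam < k" "k \<le> sum_list lam" | "sum_list lam < k" by linarith
  then show ?thesis
  proof cases
    case 2
    then have "sum_list lam - k \<le> k" "sum_list lam - k \<le> odd_index_sum lam" using T by auto
    with *[of "sum_list lam - k"] subgroup_poly_sym [OF pt 2(2)]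
    have "degree (subgroup_poly lam k) \<le> l * (sum_list lam - k) + half_weighted_sum (drop l lam)" by simp
    also have "\<dots> \<le> l * k + half_weighted_sum (drop l lam)" using \<open>sum_list lam - k \<le> k\<close> by simp
    finally show ?thesis .
  qed (auto simp: * subgroup_poly_gt [OF pt])
qed

lemma sum_list_take_le: "\<forall>y\<in>set xs. y \<le> x \<Longrightarrow> sum_list (take l xs) \<le> l * (x::nat)"
proof (induction xs arbitrary: l)
  case (Cons y ys)
  then show ?case by (cases l) (auto simp: add_mono)
qed simp

text \<open>This is the range k \<le> ev. In the formula for \<open>subgroup_poly\<close> only the
  summand X^k N_k of the tail reaches the exponent \<open>?d\<close>.\<close>

lemma lead_step:
  assumes pt: "pos_partition (x # mu)" and IH: "has_lead mu" and k: "k \<in> J_set mu l"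
  shows "degree (subgroup_poly (x # mu) k) \<le> Suc l * k + half_weighted_sum (drop l mu)"
    and "coeff (subgroup_poly (x # mu) k) (Suc l * k + half_weighted_sum (drop l mu)) = C_coeff (x # mu) k"
proof -
  let ?d = "Suc l * k + half_weighted_sum (drop l mu)"
  have ptm: "pos_partition mu" "\<forall>y\<in>set mu. y \<le> x" using pt by (auto simp: pos_partition_Cons)
  have deg: "degree (subgroup_poly mu i) \<le> l' * i + half_weighted_sum (drop l' mu)" for i l' using IH by (simp add: has_lead_def)
  \<comment> \<open>The bound with the same \<open>l\<close> gives (l + 1) i + a_l, which is
    strictly increasing in i.\<close>
  have low: "coeff (monom 1 i * subgroup_poly mu i) m = 0" if "i < k" "?d \<le> m" for i m
  proof (rule coeff_monom_mult_0)
    have "l * i \<le> l * k" using that by simp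
    then show "degree (subgroup_poly mu i) + i < m" using deg [of i l] that unfolding mult_Suc by linarith
  qed
  have sub: "coeff (monom 1 (sum_list mu - i) * subgroup_poly mu i) m = 0" if i: "i < k - x" "?d \<le> m" for i m
  proof (cases "i \<le> sum_list mu")
    case True
    \<comment> \<open>The bound with l + 2 is used here: the first l + 1 parts of \<open>mu\<close>
      are at most \<open>x\<close> each, and i + x < k absorbs them, while the remaining parts
      account for a_l - a_(l+2).\<close>
    have "Suc l * (i + x + 1) \<le> Suc l * k" using i by (intro mult_le_mono2) auto
    then have 1: "Suc l * i + Suc l * x < Suc l * k" by (simp add: algebra_simps)
    have 2: "sum_list (take (Suc l) mu) \<le> Suc l * x" using ptm(2) by (rule sum_list_take_le)
    have 3: "sum_list mu = sum_list (take (Suc l) mu) + sum_list (drop (Suc l) mu)"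
      by (metis append_take_drop_id sum_list.append)
    have 4: "sum_list (drop (Suc l) mu) = odd_index_sum (drop (Suc l) mu) + odd_index_sum (drop (Suc (Suc l)) mu)"
      using odd_index_sum_add_odd_index_sum_tl [of "drop (Suc l) mu"] by (simp add: drop_Suc tl_drop)
    have 5: "half_weighted_sum (drop l mu) = half_weighted_sum (drop (Suc (Suc l)) mu) + odd_index_sum (drop (Suc l) mu) + odd_index_sum (drop (Suc (Suc l)) mu)"
      using half_weighted_sum_drop [of l mu] half_weighted_sum_drop [of "Suc l" mu] by simp
    have "degree (subgroup_poly mu i) + (sum_list mu - i) \<le> Suc (Suc l) * i + half_weighted_sum (drop (Suc (Suc l)) mu) + (sum_list mu - i)"
      using deg [of i "Suc (Suc l)"] by simp
    also have "\<dots> = Suc l * i + half_weighted_sum (drop (Suc (Suc l)) mu) + sum_list mu" using True by simp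
    also have "\<dots> < ?d" using 1 2 3 4 5 by linarith
    finally show ?thesis using i by (intro coeff_monom_mult_0) simp
  next
    case False
    then show ?thesis using subgroup_poly_gt [OF ptm(1)] by simp
  qed
  have co: "coeff (subgroup_poly (x # mu) k) m = coeff (monom 1 k * subgroup_poly mu k) m" if "?d \<le> m" for m
    using that low sub by (simp add: subgroup_poly.simps(2) [of x mu] coeff_sum lessThan_Suc_atMost [symmetric])
  show "degree (subgroup_poly (x # mu) k) \<le> ?d"
  proof (rule degree_le, intro allI impI)
    fix m assume "m > ?d"
    then have "degree (subgroup_poly mu k) + k < m" using deg [of k l] by simp
    then show "coeff (subgroup_poly (x # mu) k) m = 0" using co [of m] \<open>m > ?d\<close> coeff_monom_mult_0 by simp
  qed
  have "k \<le> odd_index_sum mu" using k odd_index_sum_drop_antimono [OF ptm(1), of 0 l] by (simp add: J_set_eq)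
  moreover have "coeff (monom 1 k * subgroup_poly mu k) ?d = coeff (subgroup_poly mu k) (l * k + half_weighted_sum (drop l mu))"
    by (simp add: coeff_monom_mult)
  ultimately show "coeff (subgroup_poly (x # mu) k) ?d = C_coeff (x # mu) k"
    using co [of ?d] IH k C_cut [OF pt] by (simp add: has_lead_def)
qed

text \<open>
  The summands of highest degree are those with index in \<open>J\<^sub>-\<^sub>1\<close> of the tail, on which
  the degree of \<open>X\<^sup>i N\<^sub>i\<close> is constant and maximal.
\<close>

lemma coeff_plateau:
  assumes pt: "pos_partition (y # nu)" and IH: "has_lead (y # nu)"
  defines "M \<equiv> half_weighted_sum (y # nu) + odd_index_sum (y # nu)"
  shows "m > M \<Longrightarrow> coeff (monom 1 i * subgroup_poly (y # nu) i) m = 0"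
    and "coeff (monom 1 i * subgroup_poly (y # nu) i) M = (if y \<le> i \<and> i - y \<in> J_set nu 0 then C_coeff nu (i - y) else 0)"
proof -
  let ?mu = "y # nu"
  have ptn: "pos_partition nu" using pt by (simp add: pos_partition_Cons)
  have deg: "degree (subgroup_poly ?mu i) \<le> l' * i + half_weighted_sum (drop l' ?mu)" for i l' using IH unfolding has_lead_def by blast
  have o: "odd_index_sum nu + odd_index_sum (tl nu) = sum_list nu" "odd_index_sum (tl nu) \<le> odd_index_sum nu" "odd_index_sum ?mu = y + odd_index_sum (tl nu)"
    "half_weighted_sum ?mu = half_weighted_sum nu + odd_index_sum nu" "half_weighted_sum nu = half_weighted_sum (tl nu) + odd_index_sum (tl nu)"
    using odd_index_sum_add_odd_index_sum_tl odd_index_sum_tl_le ptn half_weighted_sum_drop [of 0 nu] by (auto simp: odd_index_sum_Cons drop_Suc)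
  have "(m > M \<longrightarrow> coeff (monom 1 i * subgroup_poly ?mu i) m = 0) \<and>
    coeff (monom 1 i * subgroup_poly ?mu i) M = (if y \<le> i \<and> i - y \<in> J_set nu 0 then C_coeff nu (i - y) else 0)" for m
  proof -
    consider (low) "i < odd_index_sum ?mu" | (mid) "odd_index_sum ?mu \<le> i" "i \<le> sum_list ?mu" | (high) "sum_list ?mu < i" by linarith
    then show ?thesis
    proof cases
      case low
      have "degree (subgroup_poly ?mu i) \<le> half_weighted_sum ?mu" using deg [of i 0] by simp
      then have "degree (subgroup_poly ?mu i) + i < M" using low by (simp add: M_def)
      then show ?thesis using low o by (auto simp: coeff_monom_mult_0 J_set_0)
    next
      case high
      then show ?thesis using o by (auto simp: subgroup_poly_gt [OF pt] J_set_0)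
    next
      case mid
      define j where "j = sum_list ?mu - i"
      have ij: "i + j = sum_list ?mu" "j \<le> odd_index_sum nu" "i - y = sum_list nu - j" "y \<le> i"
        using mid o by (auto simp: j_def)
      have Qj: "subgroup_poly ?mu i = subgroup_poly ?mu j" using subgroup_poly_sym [OF pt mid(2)] by (simp add: j_def)
      \<comment> \<open>By symmetry N_i may be replaced by N_j; the bound with l = 1 then gives i +
        j + a_1, which is constant as i + j = |mu|.\<close>
      have Mj: "M = i + (j + half_weighted_sum nu)" using ij o by (simp add: M_def)
      have "degree (subgroup_poly ?mu j) \<le> j + half_weighted_sum nu" using deg [of j 1] by simp
      then have hi: "m > M \<longrightarrow> coeff (monom 1 i * subgroup_poly ?mu i) m = 0"
        unfolding Qj Mj by (simp add: coeff_monom_mult_0)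
      show ?thesis
      proof (cases "odd_index_sum (tl nu) \<le> j")
        case True
        then have j: "j \<in> J_set ?mu 1" using ij by (simp add: J_set_eq drop_Suc)
        have "coeff (monom 1 i * subgroup_poly ?mu i) M = coeff (subgroup_poly ?mu j) (1 * j + half_weighted_sum (drop 1 ?mu))"
          unfolding Qj Mj by (simp add: coeff_monom_mult)
        also have "\<dots> = C_coeff ?mu j" using IH j unfolding has_lead_def by blast
        also have "\<dots> = C_coeff nu j" using C_cut [OF pt] ij by simp
        also have "\<dots> = C_coeff nu (i - y)" unfolding ij using C_sym [OF ptn, of j] ij o by simp
        finally show ?thesis using hi True ij o by (auto simp: J_set_0)
      next
        case False
        \<comment> \<open>Below J_1 the bound with l = 2 is strictly smaller than the one with l =
          1.\<close>
        have "degree (subgroup_poly ?mu j) \<le> 2 * j + half_weighted_sum (tl nu)" using deg [of j 2] by (simp add: numeral_2_eq_2 drop_Suc)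
        then have "degree (subgroup_poly ?mu j) + i < M" using Mj False o by simp
        then show ?thesis using hi False ij o by (auto simp: coeff_monom_mult_0 J_set_0 Qj)
      qed
    qed
  qed
  then show "m > M \<Longrightarrow> coeff (monom 1 i * subgroup_poly ?mu i) m = 0"
    "coeff (monom 1 i * subgroup_poly ?mu i) M = (if y \<le> i \<and> i - y \<in> J_set nu 0 then C_coeff nu (i - y) else 0)"
    by blast+
qed

text \<open>By the symmetry of \<open>y # nu\<close> each nonzero subtracted summand also has the
  form X^j N_j, so \<open>coeff_plateau\<close> evaluates both sums; what survives the cancellation
  is the sum over the window.\<close>

lemma lead_J0:
  assumes pt: "pos_partition (x # y # nu)" and IH: "has_lead (y # nu)" and k: "k \<in> J_set (x # y # nu) 0"
  shows "degree (subgroup_poly (x # y # nu) k) \<le> half_weighted_sum (x # y # nu)"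
    and "coeff (subgroup_poly (x # y # nu) k) (half_weighted_sum (x # y # nu)) = C_coeff (x # y # nu) k"
proof -
  let ?mu = "y # nu"
  let ?M = "half_weighted_sum (x # ?mu)"
  have M: "?M = half_weighted_sum ?mu + odd_index_sum ?mu" by simp
  have ptm: "pos_partition ?mu" "pos_partition nu" "y \<le> x" using pt by (auto simp: pos_partition_Cons)
  have o: "odd_index_sum nu + odd_index_sum (tl nu) = sum_list nu" "odd_index_sum (tl nu) \<le> odd_index_sum nu"
    using odd_index_sum_add_odd_index_sum_tl odd_index_sum_tl_le ptm by auto
  note plateau = coeff_plateau [OF ptm(1) IH, folded M]
  have sub: "monom 1 (sum_list ?mu - i) * subgroup_poly ?mu i = monom 1 (sum_list ?mu - i) * subgroup_poly ?mu (sum_list ?mu - i)"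
    if "i \<le> sum_list ?mu" for i
    using subgroup_poly_sym [OF ptm(1) that] by simp
  have sub0: "coeff (monom 1 (sum_list ?mu - i) * subgroup_poly ?mu i) m = 0" if "m > ?M" for i m
  proof (cases "i \<le> sum_list ?mu")
    case True
    show ?thesis unfolding sub [OF True] by (rule plateau(1) [OF that])
  next
    case False
    then show ?thesis using subgroup_poly_gt [OF ptm(1), of i] by simp
  qed
  have subM: "coeff (monom 1 (sum_list ?mu - i) * subgroup_poly ?mu i) ?M = (if i \<in> J_set nu 0 then C_coeff nu i else 0)" for i
  proof (cases "i \<le> sum_list ?mu")
    case True
    have "y \<le> sum_list ?mu - i \<and> sum_list ?mu - i - y \<in> J_set nu 0 \<longleftrightarrow> i \<in> J_set nu 0"
      using o True by (auto simp: J_set_0)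
    moreover have "C_coeff nu (sum_list ?mu - i - y) = C_coeff nu i" if "i \<in> J_set nu 0"
      using C_sym [OF ptm(2), of i] that o by (simp add: J_set_0)
    ultimately show ?thesis unfolding sub [OF True] plateau(2) by simp
  next
    case False
    then show ?thesis using o subgroup_poly_gt [OF ptm(1), of i] by (simp add: J_set_0)
  qed
  show "degree (subgroup_poly (x # ?mu) k) \<le> ?M"
  proof (rule degree_le, intro allI impI)
    fix m assume "m > ?M"
    then show "coeff (subgroup_poly (x # ?mu) k) m = 0"
      unfolding subgroup_poly.simps(2) [of x ?mu] coeff_diff coeff_sum by (simp only: plateau(1) sub0 sum.neutral_const diff_self)
  qed
  \<comment> \<open>\<open>A\<close> and \<open>B\<close> index the contributions of the first and
    the subtracted sum, in terms of \<open>nu\<close>; \<open>B\<close> lies in \<open>A\<close>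
    because y \<le> x.\<close>
  define A where "A = {j \<in> J_set nu 0. j + y \<le> k}"
  define B where "B = {j \<in> J_set nu 0. j < k - x}"
  have "coeff (subgroup_poly (x # ?mu) k) ?M =
     (\<Sum>i\<le>k. if y \<le> i \<and> i - y \<in> J_set nu 0 then C_coeff nu (i - y) else 0)
      - (\<Sum>i<k - x. if i \<in> J_set nu 0 then C_coeff nu i else 0)"
    unfolding subgroup_poly.simps(2) [of x ?mu] coeff_diff coeff_sum by (simp only: plateau(2) subM)
  also have "(\<Sum>i\<le>k. if y \<le> i \<and> i - y \<in> J_set nu 0 then C_coeff nu (i - y) else 0)
      = (\<Sum>i\<in>{i\<in>{..k}. y \<le> i \<and> i - y \<in> J_set nu 0}. C_coeff nu (i - y))"
    by (rule sum.inter_filter [symmetric]) simp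
  also have "\<dots> = (\<Sum>j\<in>A. C_coeff nu j)"
    by (rule sum.reindex_bij_witness [where i = "\<lambda>j. j + y" and j = "\<lambda>i. i - y"]) (auto simp: A_def)
  also have "(\<Sum>i<k - x. if i \<in> J_set nu 0 then C_coeff nu i else 0) = (\<Sum>j\<in>B. C_coeff nu j)"
    unfolding B_def by (subst sum.inter_filter [symmetric]) (auto intro: sum.cong)
  also have "(\<Sum>j\<in>A. C_coeff nu j) - (\<Sum>j\<in>B. C_coeff nu j) = (\<Sum>j\<in>A - B. C_coeff nu j)"
  proof (rule sum_diff [symmetric])
    show "finite A" by (simp add: A_def J_set_def)
    show "B \<subseteq> A" using ptm(3) by (auto simp: A_def B_def)
  qed
  also have "A - B = window x y nu k" by (auto simp: A_def B_def window_def)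
  finally show "coeff (subgroup_poly (x # ?mu) k) ?M = C_coeff (x # ?mu) k"
    using C_window [OF pt k] by simp
qed

lemma has_lead_pos_partition: "pos_partition lam \<Longrightarrow> has_lead lam"
proof (induction lam)
  case Nil
  show ?case by (simp add: has_lead_def J_set_eq C_short subgroup_poly.simps)
next
  case (Cons x mu)
  then have IH: "has_lead mu" by (simp add: pos_partition_Cons)
  have "degree (subgroup_poly (x # mu) k) \<le> l * k + half_weighted_sum (drop l (x # mu)) \<and>
    coeff (subgroup_poly (x # mu) k) (l * k + half_weighted_sum (drop l (x # mu))) = C_coeff (x # mu) k"
    if k: "k \<in> J_set (x # mu) l" for k l
  proof (cases l)
    case (Suc l')
    then have "k \<in> J_set mu l'" using k by (simp add: J_set_Cons)
    from lead_step [OF Cons.prems IH this] show ?thesis using Suc by simp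
  next
    case 0
    show ?thesis
    proof (cases mu)
      case Nil
      \<comment> \<open>Only i = 0 contributes to the first sum, and the subtracted one is empty for
        k \<le> x.\<close>
      have "subgroup_poly [x] k = 1" if "k \<le> x"
        using that by (simp add: subgroup_poly.simps if_distrib sum.delta cong: if_cong)
      moreover have "k \<le> x" using k Nil 0 by (simp add: J_set_0)
      ultimately show ?thesis using Nil 0 by (simp add: C_short)
    next
      case (Cons y nu)
      with lead_J0 [of x y nu k] IH Cons.prems k 0 \<open>pos_partition (x # mu)\<close> show ?thesis by simp
    qed
  qed
  then show ?case
    using degree_subgroup_poly_extend [OF Cons.prems] by (auto simp: has_lead_def)
qed

section \<open>Highest terms of the counting polynomials\<close>

lemma hterm_eq:
  assumes "degree P \<le> d" "coeff P d = c" "c \<noteq> 0"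
  shows "hterm P = monom c d" "degree P = d"
proof -
  show "degree P = d" using assms by (metis le_antisym le_degree)
  then show "hterm P = monom c d" using assms by (simp add: hterm_def)
qed

text \<open>Positivity of C turns the degree bound of \<open>has_lead\<close> into the exact
  degree.\<close>

lemma lead_N_poly:
  assumes "pos_partition lam" "k \<in> J_set lam l"
  shows "hterm (N_poly lam k) = monom (C_coeff lam k) (l * k + a_sum lam l)"
    and "degree (N_poly lam k) = l * k + a_sum lam l"
proof -
  have "k \<le> sum_list lam"
    using assms odd_index_sum_drop_antimono [OF assms(1), of 0 l] odd_index_sum_le [of lam] by (simp add: J_set_eq)
  then have "C_coeff lam k \<noteq> 0" using C_pos [OF assms(1)] by (metis less_irrefl)
  then show "hterm (N_poly lam k) = monom (C_coeff lam k) (l * k + a_sum lam l)"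
    "degree (N_poly lam k) = l * k + a_sum lam l"
    using hterm_eq has_lead_pos_partition [OF assms(1)] assms(2)
    unfolding has_lead_def N_poly_eq [OF assms(1)] a_sum_eq by blast+
qed

theorem theorem2p1:
  fixes n :: nat and lam :: "nat list"
  assumes "n \<ge> 1" and "lam \<in> Lambda_plus n"
  shows
    "(\<forall>l k. l \<le> n - 1 \<and> k \<in> J_set lam l \<longrightarrow>
        hterm (N_poly lam k) = Polynomial.monom (C_coeff lam k) (l * k + a_sum lam l))
   \<and> (\<forall>k. sum_list lam \<le> 2 * k \<and> k \<le> sum_list lam \<longrightarrow>
        hterm (N_poly lam k) = hterm (N_poly lam (sum_list lam - k)))
   \<and> (\<forall>l k. 1 \<le> l \<and> l \<le> n - 1 \<and> k \<in> J_neg_set lam l \<longrightarrow>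
        hterm (N_poly lam k) =
          Polynomial.monom (C_coeff lam (sum_list lam - k)) (l * sum_list lam + a_sum lam l - l * k))
   \<and> (n \<le> 2 \<longrightarrow> (\<forall>k \<le> sum_list lam. C_coeff lam k = 1))
   \<and> (n \<ge> 2 \<longrightarrow>
        (\<forall>l k. 1 \<le> l \<and> l \<le> n - 1 \<and> k \<in> J_set lam l \<longrightarrow>
            J_set lam l = J_set (drop l lam) 0 \<and> C_coeff lam k = C_coeff (drop l lam) k)
      \<and> (\<forall>k \<in> J_set lam 0.
            C_coeff lam k = (\<Sum>i = max (ev_sum lam) (k + part lam 2 - part lam 1)
                         ..min k (od_sum lam + part lam 2 - part lam 1). C_coeff (drop 1 lam) i)))
   \<and> (\<forall>l \<le> n - 1.
        unimodal_on (C_coeff lam) (J_set lam l)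
      \<and> (\<forall>k \<in> J_set lam l. C_coeff lam k = C_coeff lam (sum_list (drop l lam) - k))
      \<and> C_coeff lam (c_sum lam l) = 1)
   \<and> H_max lam = a_sum lam 0
   \<and> a_sum lam 0 = (\<Sum>i = 2..n. (i div 2) * part lam i)"
proof -
  have pt: "pos_partition lam" and len: "length lam = n"
    using assms(2) by (auto simp: Lambda_plus_def pos_partition_def)
  have sym: "N_poly lam (sum_list lam - k) = N_poly lam k" if "k \<le> sum_list lam" for k
    using that subgroup_poly_sym [OF pt] by (simp add: N_poly_eq [OF pt])
  have neg: "hterm (N_poly lam k) =
      monom (C_coeff lam (sum_list lam - k)) (l * sum_list lam + a_sum lam l - l * k)"
    if k: "k \<in> J_neg_set lam l" for k l
  proof -
    \<comment> \<open>Keeps the subtractions in \<open>c_neg_sum\<close> from truncating, so that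
      reflection takes J_(-l) to J_l.\<close>
    have "c_sum lam l \<le> sum_list lam" "c_sum lam (Suc l) \<le> sum_list lam"
      using odd_index_sum_drop_antimono [OF pt, of 0] odd_index_sum_le [of lam]
      unfolding c_sum_eq by (metis drop_0 le0 order_trans)+
    then have "k \<le> sum_list lam" and J: "sum_list lam - k \<in> J_set lam l"
      using k by (auto simp: J_neg_set_def c_neg_sum_def J_set_def)
    moreover have "l * (sum_list lam - k) + a_sum lam l = l * sum_list lam + a_sum lam l - l * k"
      using \<open>k \<le> sum_list lam\<close> by (simp add: diff_mult_distrib2)
    ultimately show ?thesis using lead_N_poly(1) [OF pt J] sym by simp
  qed
  have drop: "J_set lam l = J_set (drop l lam) 0"
    and C_J: "k \<in> J_set lam l \<Longrightarrow> C_coeff lam k = C_coeff (drop l lam) k" for k l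
    using C_drop [OF pt, of k l] by (auto simp: J_set_eq)
  have sum: "C_coeff lam k = (\<Sum>i = max (ev_sum lam) (k + part lam 2 - part lam 1)
       ..min k (od_sum lam + part lam 2 - part lam 1). C_coeff (drop 1 lam) i)"
    if "n \<ge> 2" "k \<in> J_set lam 0" for k
  proof -
    obtain x y nu where lam: "lam = x # y # nu"
      using \<open>n \<ge> 2\<close> len by (cases lam rule: odd_index_sum.cases) auto
    show ?thesis
      using C_sum [of x y nu k] pt that(2) unfolding lam by (simp add: ev_sum_eq od_sum_eq part_def)
  qed
  have props: "unimodal_on (C_coeff lam) (J_set lam l)
      \<and> (\<forall>k \<in> J_set lam l. C_coeff lam k = C_coeff lam (sum_list (drop l lam) - k))
      \<and> C_coeff lam (c_sum lam l) = 1" for l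
  proof -
    let ?nu = "drop l lam"
    let ?J = "J_set ?nu 0"
    have ptn: "pos_partition ?nu" using pt by (rule pos_partition_drop)
    have o: "odd_index_sum ?nu + odd_index_sum (tl ?nu) = sum_list ?nu" "odd_index_sum (tl ?nu) \<le> odd_index_sum ?nu"
      using odd_index_sum_add_odd_index_sum_tl odd_index_sum_tl_le ptn by auto
    have C: "C_coeff lam k = C_coeff ?nu k" if "k \<in> ?J" for k
      using that C_J drop by simp
    have s: "C_coeff ?nu (sum_list ?nu - k) = C_coeff ?nu k" if "k \<in> ?J" for k
      using C_sym [OF ptn, of k] that o by (simp add: J_set_0)
    have refl: "sum_list ?nu - k \<in> ?J" if "k \<in> ?J" for k
      using that o by (auto simp: J_set_0)
    \<comment> \<open>The centre of symmetry rounded down serves as the peak.\<close>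
    define m where "m = sum_list ?nu div 2"
    have "mono_on {k \<in> ?J. k \<le> m} (C_coeff lam)"
    proof (rule mono_onI)
      fix i j assume ij: "i \<in> {k \<in> ?J. k \<le> m}" "j \<in> {k \<in> ?J. k \<le> m}" "i \<le> j"
      then have "i + j \<le> sum_list ?nu" by (auto simp: m_def)
      with ij show "C_coeff lam i \<le> C_coeff lam j"
        using C_unimodal [OF ptn, of i j] by (simp add: C) (simp add: J_set_0)
    qed
    moreover have "antimono_on {k \<in> ?J. m \<le> k} (C_coeff lam)"
    proof (rule monotone_onI)
      fix i j assume ij: "i \<in> {k \<in> ?J. m \<le> k}" "j \<in> {k \<in> ?J. m \<le> k}" "i \<le> j"
      show "C_coeff lam j \<le> C_coeff lam i"
      \<comment> \<open>For i < j the rounding in \<open>m\<close> is harmless, since i + j \<ge> 2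
        m + 1 \<ge> |nu|; for i = j = m this could fail.\<close>
      proof (cases "i = j")
        case False
        with ij have "i + j \<ge> sum_list ?nu" by (auto simp: m_def)
        then have "C_coeff ?nu (sum_list ?nu - j) \<le> C_coeff ?nu i"
          using ij o C_sym [OF ptn, of i] 
            C_unimodal [OF ptn, of "sum_list ?nu - j" "sum_list ?nu - i"] by (auto simp: J_set_0)
        then show ?thesis using ij s C by auto
      qed simp
    qed
    moreover have "m \<in> ?J" using o by (auto simp: m_def J_set_0)
    ultimately have "unimodal_on (C_coeff lam) (J_set lam l)"
      unfolding unimodal_on_def drop by blast
    moreover have "C_coeff lam (c_sum lam l) = 1"
      using C_odd_index_sum [OF ptn] C [of "odd_index_sum ?nu"] o by (simp add: c_sum_eq J_set_0)
    ultimately show ?thesis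
      using s C refl unfolding drop by auto
  qed
  have "H_max lam = a_sum lam 0"
    unfolding H_max_def
  proof (rule Max_eqI)
    fix d assume "d \<in> (\<lambda>k. degree (N_poly lam k)) ` {0..sum_list lam}"
    then obtain k where "d = degree (subgroup_poly lam k)" by (auto simp: N_poly_eq [OF pt])
    moreover have "degree (subgroup_poly lam k) \<le> 0 * k + half_weighted_sum (drop 0 lam)"
      using has_lead_pos_partition [OF pt] unfolding has_lead_def by blast
    ultimately show "d \<le> a_sum lam 0" by (simp add: a_sum_eq)
  next
    \<comment> \<open>The maximum is attained at k = od, where l = 0 gives degree a_0.\<close>
    have "odd_index_sum lam \<in> J_set lam 0" using odd_index_sum_tl_le [OF pt] by (simp add: J_set_0)
    from lead_N_poly(2) [OF pt this] odd_index_sum_le [of lam]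
    show "a_sum lam 0 \<in> (\<lambda>k. degree (N_poly lam k)) ` {0..sum_list lam}"
      by (intro image_eqI [of _ _ "odd_index_sum lam"]) auto
  qed simp
  moreover have "a_sum lam 0 = (\<Sum>i = 2..n. (i div 2) * part lam i)"
    by (simp add: a_sum_def len numeral_2_eq_2)
  moreover have "n \<le> 2 \<longrightarrow> (\<forall>k \<le> sum_list lam. C_coeff lam k = 1)"
    using len by (simp add: C_short)
  moreover have "\<forall>k. sum_list lam \<le> 2 * k \<and> k \<le> sum_list lam \<longrightarrow>
      hterm (N_poly lam k) = hterm (N_poly lam (sum_list lam - k))"
    using sym by simp
  ultimately show ?thesis
  proof (intro conjI)
    show "\<forall>l k. l \<le> n - 1 \<and> k \<in> J_set lam l \<longrightarrow>
        hterm (N_poly lam k) = monom (C_coeff lam k) (l * k + a_sum lam l)"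
      using lead_N_poly(1) [OF pt] by blast
    show "\<forall>l k. 1 \<le> l \<and> l \<le> n - 1 \<and> k \<in> J_neg_set lam l \<longrightarrow> hterm (N_poly lam k) =
        monom (C_coeff lam (sum_list lam - k)) (l * sum_list lam + a_sum lam l - l * k)"
      using neg by blast
    show "n \<ge> 2 \<longrightarrow>
        (\<forall>l k. 1 \<le> l \<and> l \<le> n - 1 \<and> k \<in> J_set lam l \<longrightarrow>
            J_set lam l = J_set (drop l lam) 0 \<and> C_coeff lam k = C_coeff (drop l lam) k)
      \<and> (\<forall>k \<in> J_set lam 0.
            C_coeff lam k = (\<Sum>i = max (ev_sum lam) (k + part lam 2 - part lam 1)
                         ..min k (od_sum lam + part lam 2 - part lam 1). C_coeff (drop 1 lam) i))"
      using drop C_J sum by (intro impI conjI allI ballI) blast+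
  qed (use props in \<open>assumption | blast\<close>)+
qed

end
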